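(* Let $N>K\ge1$, $X\in\mathbb G_N$ and $Y=(y_1,\dots,y_K)\in\mathbb G_K$. Then $$\Lambda^N_K(X,Y)=V(Y)\prod_{i=1}^K\frac{(q;q)_{N-i}}{(q;q)_{K-i}(q;q)_{N-K}}\cdot\frac{(1-q^{N-K})^K|y_1|\cdots|y_K|}{(2\pi\sqrt{-1})^K}\int_{C(y_1)}\cdots\int_{C(y_K)}V(Z^{-1})\prod_{j=1}^K\frac{(y_jz_j^{-1}q;q)_{N-K-1}}{\prod_{x\in X}(1-xz_j^{-1})}\,\frac{dz_1}{z_1^2}\cdots\frac{dz_K}{z_K^2},$$ where $z_j$ ranges over $C(y_j)$ and $V(Z^{-1})=V(z_1^{-1},\dots,z_K^{-1})$.
   Context: Fix $q\in(0,1)$, $\zeta_+>0$, $\zeta_-<0$. Let $\mathfrak L=\{\zeta_+q^n:n\in\mathbb Z\}\cup\{\zeta_-q^n:n\in\mathbb Z\}\subset\mathbb R$. For $a<a'$ in $\mathfrak L$ set $I(a,a')=[a,a')\cap\mathfrak L$ if $a<a'<0$; $I(a,a')=[a,a']\cap\mathfrak L$ if $a<0<a'$; $I(a,a')=(a,a']\cap\mathfrak L$ if $0<a<a'$. For $M\ge1$, $\mathbb G_M$ is the set of $M$-point subsets $A=(a_1<\dots<a_M)$ of $\mathfrak L$. Write $|A|=|a_1|\cdots|a_M|$, $V(a_1,\dots,a_M)=\prod_{1\le i<j\le M}(a_i-a_j)$, $V(A)=V(a_1,\dots,a_M)$, and $|V(A)|$ for its absolute value. For $X=(x_1<\dots<x_{N+1})\in\mathbb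 G_{N+1}$ and $Y=(y_1<\dots<y_N)\in\mathbb G_N$ write $Y\prec X$ if $y_i\in I(x_i,x_{i+1})$ for $i=1,\dots,N$. Set $$\Lambda^{N+1}_N(X,Y)=(q;q)_N\,|Y|\,\frac{|V(Y)|}{|V(X)|}\ \text{ if } Y\prec X,\qquad \Lambda^{N+1}_N(X,Y)=0\ \text{ otherwise},$$ where $(a;q)_N=\prod_{i=0}^{N-1}(1-aq^i)$. This is a stochastic matrix of format $\mathbb G_{N+1}\times\mathbb G_N$. For $N>K\ge1$ put $\Lambda^N_K=\Lambda^N_{N-1}\cdots\Lambda^{K+1}_K$, a stochastic matrix of format $\mathbb G_N\times\mathbb G_K$. For $y\in\mathfrak L$, $C(y)$ denotes a vertical line in $\mathbb C$ separating $y$ and $yq$, oriented from top to bottom: $C(y)=(a+\sqrt{-1}\,\infty,\;a-\sqrt{-1}\,\infty)$ with $a\in\mathbb R$ chosen arbitrarily strictly between $y$ and $yq$. The right-hand side of the formula does not depend on the enumeration of the points of $Y$. *)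

theory Defs
  imports "HOL-Analysis.Analysis"
begin

definition qlattice :: "real \<Rightarrow> real \<Rightarrow> real \<Rightarrow> real set" where
  "qlattice q zp zm = {zp * q powi n |n. True} \<union> {zm * q powi n |n. True}"

text \<open>The set \<open>I(a,a')\<close> is only meaningful for \<open>a < a'\<close> in the lattice. As \<open>0\<close> is not a
  lattice point, the last case is then exactly \<open>0 < a\<close>.\<close>

definition qinterval :: "real \<Rightarrow> real \<Rightarrow> real \<Rightarrow> real \<Rightarrow> real \<Rightarrow> real set" where
  "qinterval q zp zm a a' =
     (if a' < 0 then {a..<a'} else if a < 0 then {a..a'} else {a<..a'}) \<inter> qlattice q zp zm"

definition configs :: "real \<Rightarrow> real \<Rightarrow> real \<Rightarrow> nat \<Rightarrow> real set set" where
  "configs q zp zm M = {A. A \<subseteq> qlattice q zp zm \<and> finite A \<and> card A = M}"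

definition vandermonde :: "'a::comm_ring_1 list \<Rightarrow> 'a" where
  "vandermonde xs = (\<Prod>j<length xs. \<Prod>i<j. xs ! i - xs ! j)"

definition qpoch :: "'a::comm_ring_1 \<Rightarrow> 'a \<Rightarrow> nat \<Rightarrow> 'a" where
  "qpoch a q n = (\<Prod>i<n. 1 - a * q ^ i)"

text \<open>\<open>Y \<prec> X\<close> for an \<open>N\<close>-point set \<open>Y\<close> and an \<open>(N+1)\<close>-point set \<open>X\<close>, both enumerated in
  increasing order.\<close>

definition interlaces :: "real \<Rightarrow> real \<Rightarrow> real \<Rightarrow> nat \<Rightarrow> real set \<Rightarrow> real set \<Rightarrow> bool" where
  "interlaces q zp zm N Y X \<longleftrightarrow>
     (\<forall>i<N. sorted_list_of_set Y ! i \<in>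
        qinterval q zp zm (sorted_list_of_set X ! i) (sorted_list_of_set X ! Suc i))"

text \<open>The one-step matrix from \<open>N+1\<close> to \<open>N\<close> points; the index \<open>N\<close> is the smaller size.\<close>

definition link1 :: "real \<Rightarrow> real \<Rightarrow> real \<Rightarrow> nat \<Rightarrow> real set \<Rightarrow> real set \<Rightarrow> real" where
  "link1 q zp zm N X Y =
     (if interlaces q zp zm N Y X
      then qpoch q q N * (\<Prod>y\<in>Y. \<bar>y\<bar>) *
           (\<bar>vandermonde (sorted_list_of_set Y)\<bar> / \<bar>vandermonde (sorted_list_of_set X)\<bar>)
      else 0)"

text \<open>\<open>link q zp zm K N\<close> is the matrix product of the one-step matrices from \<open>N\<close> down to \<open>K\<close>
  points. It is only meaningful for \<open>N > K\<close>. A configuration with points on both sides of \<open>0\<close>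
  dominates infinitely many others, so the intermediate sums are infinite in general.\<close>

primrec link :: "real \<Rightarrow> real \<Rightarrow> real \<Rightarrow> nat \<Rightarrow> nat \<Rightarrow> real set \<Rightarrow> real set \<Rightarrow> real" where
  "link q zp zm K 0 = (\<lambda>X Y. 0)"
| "link q zp zm K (Suc N) =
     (if N = K then link1 q zp zm K
      else (\<lambda>X Y. \<Sum>\<^sub>\<infinity>Z\<in>configs q zp zm N. link1 q zp zm N X Z * link q zp zm K N Z Y))"

text \<open>Integral over the vertical line through \<open>a\<close>, oriented from top to bottom: \<open>dz = -\<i> dt\<close>
  for \<open>z = a + \<i> t\<close> with \<open>t\<close> increasing.\<close>

definition vline_integral :: "real \<Rightarrow> (complex \<Rightarrow> complex) \<Rightarrow> complex" where
  "vline_integral a f = - \<i> * (LINT t|lborel. f (Complex a t))"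

primrec iterated_vline_integral :: "real list \<Rightarrow> (complex list \<Rightarrow> complex) \<Rightarrow> complex" where
  "iterated_vline_integral [] f = f []"
| "iterated_vline_integral (a # as) f =
     vline_integral a (\<lambda>z. iterated_vline_integral as (\<lambda>zs. f (z # zs)))"

end

theory Submission
  imports Defs "Jordan_Normal_Form.Determinant" "HOL-Probability.Sinc_Integral"
begin

text \<open>
  List configurations in decreasing order, \<open>x\<^sub>1 > \<dots> > x\<^sub>N\<close>. For \<open>y > 0\<close> let
  \<open>f\<^sub>y(x) = (x - yq) \<dots> (x - yq\<^bsup>N-K-1\<^esup>)\<close> if \<open>x \<ge> y\<close> and \<open>0\<close> otherwise; for \<open>y < 0\<close> take minus this
  product if \<open>x \<le> y\<close> and \<open>0\<close> otherwise. Up to a constant,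
  \<open>V(X) \<Lambda>(X, Y) = V(Y) |Y| det[f\<^bsub>y\<^sub>1\<^esub>(x), \<dots>, f\<^bsub>y\<^sub>K\<^esub>(x), x\<^bsup>N-K-1\<^esup>, \<dots>, x, 1]\<close>, by induction on \<open>N\<close>:
  the rows of the determinant for \<open>Z \<prec> X\<close> are summed independently over the intervals
  \<open>I(x\<^bsub>i+1\<^esub>, x\<^sub>i)\<close>, each sum is a difference of values of a \<open>q\<close>-antiderivative, and the
  \<open>q\<close>-antiderivatives of the columns for \<open>N\<close> are multiples of the columns for \<open>N + 1\<close>.
  Multiplying by the matrix of the functionals \<open>h \<mapsto> [x\<^sub>1, \<dots>, x\<^sub>N](x\<^sup>r h)\<close> (divided differences)
  turns this determinant into \<open>V(X)\<close> times the \<open>K \<times> K\<close> determinant of the divided differences of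
  \<open>x\<^sup>r f\<^sub>y\<close>. These are the integrals over single vertical lines, which partial fractions
  reduce to arctangent integrals.
\<close>

section \<open>Determinants\<close>

text \<open>Entries are a function on all index pairs, so a block is an index shift and entries are
  rewritten without carrier conditions.\<close>

abbreviation (input) fdet :: "nat \<Rightarrow> (nat \<Rightarrow> nat \<Rightarrow> 'a::comm_ring_1) \<Rightarrow> 'a" where
  "fdet n A \<equiv> Determinant.det (Matrix.mat n n (\<lambda>(i, j). A i j))"

lemma fdet_Leibniz:
  "fdet n A = (\<Sum>p | p permutes {..<n}. signof p * (\<Prod>i<n. A i (p i)))"
proof -
  have "fdet n A = (\<Sum>p | p permutes {0..<n}. signof p * (\<Prod>i=0..<n. Matrix.mat n n (\<lambda>(i, j). A i j) $$ (i, p i)))"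
    by (rule Determinant.det_def') simp
  also have "\<dots> = (\<Sum>p | p permutes {..<n}. signof p * (\<Prod>i<n. A i (p i)))"
    unfolding lessThan_atLeast0
    by (intro sum.cong refl arg_cong2[where f = "(*)"] prod.cong)
       (auto dest: permutes_in_image)
  finally show ?thesis .
qed

lemma fdet_cong:
  assumes "\<And>i j. i < n \<Longrightarrow> j < n \<Longrightarrow> A i j = B i j"
  shows "fdet n A = fdet n B"
  by (rule arg_cong[where f = Determinant.det], rule eq_matI) (use assms in auto)

lemma fdet_scale_rows: "fdet n (\<lambda>i j. a i * A i j) = (\<Prod>i<n. a i) * fdet n A"
  unfolding fdet_Leibniz sum_distrib_left by (simp add: prod.distrib mult_ac)

lemma fdet_scale_cols: "fdet n (\<lambda>i j. a j * A i j) = (\<Prod>j<n. a j) * fdet n A"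
  unfolding fdet_Leibniz sum_distrib_left
proof (intro sum.cong refl)
  fix p assume "p \<in> {p. p permutes {..<n}}"
  then have "(\<Prod>i<n. a (p i)) = (\<Prod>i<n. a i)"
    using prod.permute[of p "{..<n}" a] by (simp add: o_def)
  then show "signof p * (\<Prod>i<n. a (p i) * A i (p i)) = prod a {..<n} * (signof p * (\<Prod>i<n. A i (p i)))"
    by (simp add: prod.distrib mult_ac)
qed

lemma fdet_transpose: "fdet n (\<lambda>i j. A j i) = fdet n A"
proof -
  have "transpose_mat (Matrix.mat n n (\<lambda>(i, j). A i j)) = Matrix.mat n n (\<lambda>(i, j). A j i)"
    by (rule eq_matI) auto
  then show ?thesis
    using Determinant.det_transpose[of "Matrix.mat n n (\<lambda>(i, j). A i j)" n] by simp
qed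

lemma fdet_mult: "fdet n A * fdet n B = fdet n (\<lambda>i j. \<Sum>k<n. A i k * B k j)"
proof -
  have "Matrix.mat n n (\<lambda>(i, j). A i j) * Matrix.mat n n (\<lambda>(i, j). B i j)
      = Matrix.mat n n (\<lambda>(i, j). \<Sum>k<n. A i k * B k j)"
    by (rule eq_matI) (auto simp: scalar_prod_def lessThan_atLeast0)
  then show ?thesis
    using Determinant.det_mult[of "Matrix.mat n n (\<lambda>(i, j). A i j)" n "Matrix.mat n n (\<lambda>(i, j). B i j)"]
    by simp
qed

lemma fdet_lower_triangular:
  assumes "\<And>i j. i < j \<Longrightarrow> j < n \<Longrightarrow> A i j = 0"
  shows "fdet n A = (\<Prod>i<n. A i i)"
proof -
  have "fdet n A = prod_list (diag_mat (Matrix.mat n n (\<lambda>(i, j). A i j)))"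
    by (rule Determinant.det_lower_triangular[where n = n]) (use assms in auto)
  also have "\<dots> = (\<Prod>i<n. A i i)"
    by (simp add: prod_list_diag_prod lessThan_atLeast0)
  finally show ?thesis .
qed

lemma fdet_upper_triangular:
  assumes "\<And>i j. j < i \<Longrightarrow> i < n \<Longrightarrow> A i j = 0"
  shows "fdet n A = (\<Prod>i<n. A i i)"
  using fdet_lower_triangular[of n "\<lambda>i j. A j i"] assms by (simp only: fdet_transpose[of n A])

lemma fdet_block_upper_right_zero:
  fixes A :: "nat \<Rightarrow> nat \<Rightarrow> 'a::idom"
  assumes "\<And>i j. i < k \<Longrightarrow> k \<le> j \<Longrightarrow> j < k + m \<Longrightarrow> A i j = 0"
  shows "fdet (k + m) A = fdet k A * fdet m (\<lambda>i j. A (k + i) (k + j))"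
proof -
  have "Matrix.mat (k + m) (k + m) (\<lambda>(i, j). A i j) =
      four_block_mat (Matrix.mat k k (\<lambda>(i, j). A i j)) (0\<^sub>m k m)
        (Matrix.mat m k (\<lambda>(i, j). A (k + i) j)) (Matrix.mat m m (\<lambda>(i, j). A (k + i) (k + j)))"
    by (rule eq_matI) (use assms in auto)
  then show ?thesis
    by (simp add: det_four_block_mat_upper_right_zero[where n = k and m = m])
qed

lemma fdet_block_lower_left_zero:
  fixes A :: "nat \<Rightarrow> nat \<Rightarrow> 'a::idom"
  assumes "\<And>i j. k \<le> i \<Longrightarrow> i < k + m \<Longrightarrow> j < k \<Longrightarrow> A i j = 0"
  shows "fdet (k + m) A = fdet k A * fdet m (\<lambda>i j. A (k + i) (k + j))"
  using fdet_block_upper_right_zero[of k m "\<lambda>i j. A j i"] assms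
  by (simp only: fdet_transpose[of _ A] fdet_transpose[of m "\<lambda>i j. A (k + i) (k + j)"])

section \<open>Vandermonde determinants and row differences\<close>

lemma vandermonde_snoc:
  "vandermonde (xs @ [x]) = vandermonde xs * (\<Prod>i<length xs. xs ! i - x)"
  unfolding vandermonde_def by (simp add: nth_append)

text \<open>Products with a bidiagonal matrix carry out the elementary operations below, in which a
  multiple of the next column or row is subtracted.\<close>

lemma sum_bidiagonal:
  fixes f :: "nat \<Rightarrow> 'a::comm_ring_1"
  assumes "k < n"
  shows "(\<Sum>j<n. (if j = k then a else if j = Suc k then b else 0) * f j)
    = a * f k + (if Suc k < n then b * f (Suc k) else 0)"
proof -
  have "(\<Sum>j<n. (if j = k then a else if j = Suc k then b else 0) * f j)
      = (\<Sum>j<n. (if j = k then a * f k else 0) + (if j = Suc k then b * f (Suc k) else 0))"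
    by (intro sum.cong) auto
  also have "\<dots> = a * f k + (if Suc k < n then b * f (Suc k) else 0)"
    using assms by (simp add: sum.distrib)
  finally show ?thesis .
qed

text \<open>Column operations turn the row of the last point \<open>x\<close> into (0, ..., 0, 1)
  and give every other row i the factor \<open>xs ! i - x\<close>, which is the recursion of
  \<open>vandermonde_snoc\<close>. Falling powers go with the factors a_i - a_j for i < j, so no
  sign appears.\<close>

lemma vandermonde_det:
  fixes xs :: "'a::idom list"
  shows "vandermonde xs = fdet (length xs) (\<lambda>i k. xs ! i ^ (length xs - 1 - k))"
proof (induction xs rule: rev_induct)
  case Nil
  then show ?case by (simp add: vandermonde_def fdet_Leibniz)
next
  case (snoc x xs)
  define n where "n = length xs"
  define W where "W = (\<lambda>i k. (xs @ [x]) ! i ^ (n - k))"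
  \<comment> \<open>Right multiplication by \<open>U\<close> replaces column \<open>k\<close> by column \<open>k\<close> minus \<open>x\<close> times column \<open>k + 1\<close>.\<close>
  define U where "U = (\<lambda>j k::nat. if j = k then 1 else if j = Suc k then - x else 0)"
  have "fdet (n + 1) U = 1"
    by (subst fdet_lower_triangular) (auto simp: U_def)
  then have "fdet (n + 1) W = fdet (n + 1) (\<lambda>i k. \<Sum>j<n + 1. W i j * U j k)"
    by (simp only: fdet_mult[symmetric] mult_1_right)
  also have "\<dots> = fdet (n + 1) (\<lambda>i k. W i k - (if k < n then x * W i (Suc k) else 0))"
  proof (rule fdet_cong)
    fix i k assume "k < n + 1"
    then show "(\<Sum>j<n + 1. W i j * U j k) = W i k - (if k < n then x * W i (Suc k) else 0)"
      using sum_bidiagonal[of k "n + 1" 1 "- x" "W i"] by (simp add: U_def mult.commute)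
  qed
  also have "\<dots> = fdet n (\<lambda>i k. W i k - (if k < n then x * W i (Suc k) else 0)) * 
      fdet 1 (\<lambda>i k. W (n + i) (n + k) - (if n + k < n then x * W (n + i) (Suc (n + k)) else 0))"
    by (rule fdet_block_lower_left_zero) (auto simp: W_def n_def nth_append power_Suc[symmetric] Suc_diff_Suc simp del: power_Suc)
  also have "fdet 1 (\<lambda>i k. W (n + i) (n + k) - (if n + k < n then x * W (n + i) (Suc (n + k)) else 0)) = 1"
    by (subst fdet_lower_triangular) (auto simp: W_def)
  also have "fdet n (\<lambda>i k. W i k - (if k < n then x * W i (Suc k) else 0)) =
      fdet n (\<lambda>i k. (xs ! i - x) * xs ! i ^ (n - 1 - k))"
  proof (rule fdet_cong)
    fix i k assume *: "i < n" "k < n"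
    then have "n - k = Suc (n - 1 - k)" "n - Suc k = n - 1 - k" by auto
    with * show "W i k - (if k < n then x * W i (Suc k) else 0) = (xs ! i - x) * xs ! i ^ (n - 1 - k)"
      by (simp add: W_def n_def nth_append algebra_simps)
  qed
  also have "\<dots> = vandermonde (xs @ [x])"
    by (simp add: fdet_scale_rows vandermonde_snoc snoc.IH n_def mult.commute)
  finally show ?case
    by (simp add: W_def n_def)
qed

text \<open>Subtracting from each row the next one turns the last column into (0, ..., 0, 1). The
  differences that remain have the form of sums over the intervals between neighbouring
  points.\<close>

lemma fdet_Suc_ones:
  fixes G :: "nat \<Rightarrow> nat \<Rightarrow> 'a::idom"
  assumes "\<And>i. i \<le> n \<Longrightarrow> G i n = 1"
  shows "fdet (Suc n) G = fdet n (\<lambda>i j. G i j - G (Suc i) j)"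
proof -
  define U where "U = (\<lambda>i j::nat. if j = i then 1 else if j = Suc i then - 1 else 0 :: 'a)"
  have "fdet (n + 1) U = 1"
    by (subst fdet_upper_triangular) (auto simp: U_def)
  then have "fdet (n + 1) G = fdet (n + 1) (\<lambda>i k. \<Sum>j<n + 1. U i j * G j k)"
    by (simp only: fdet_mult[symmetric] mult_1_left)
  also have "\<dots> = fdet (n + 1) (\<lambda>i k. G i k - (if i < n then G (Suc i) k else 0))"
  proof (rule fdet_cong)
    fix i k assume "i < n + 1"
    then show "(\<Sum>j<n + 1. U i j * G j k) = G i k - (if i < n then G (Suc i) k else 0)"
      using sum_bidiagonal[of i "n + 1" 1 "- 1" "\<lambda>j. G j k"] by (simp add: U_def)
  qed
  also have "\<dots> = fdet n (\<lambda>i k. G i k - (if i < n then G (Suc i) k else 0)) *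
     fdet 1 (\<lambda>i k. G (n + i) (n + k) - (if n + i < n then G (Suc (n + i)) (n + k) else 0))"
    by (rule fdet_block_upper_right_zero) (use assms in \<open>auto simp: not_less less_Suc_eq_le dest: antisym\<close>)
  also have "fdet 1 (\<lambda>i k. G (n + i) (n + k) - (if n + i < n then G (Suc (n + i)) (n + k) else 0)) = 1"
    by (subst fdet_lower_triangular) (use assms in auto)
  also have "fdet n (\<lambda>i k. G i k - (if i < n then G (Suc i) k else 0)) = fdet n (\<lambda>i j. G i j - G (Suc i) j)"
    by (rule fdet_cong) auto
  finally show ?thesis by simp
qed

section \<open>Divided differences\<close>

text \<open>Both sides have degree below \<open>card I\<close> and agree at the
  \<open>card I\<close> nodes.\<close>

lemma lagrange_identity:
  fixes h :: "'a::field poly"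
  assumes fin: "finite I" and inj: "inj_on a I" and deg: "degree h < card I"
  shows "h = (\<Sum>i\<in>I. Polynomial.smult (poly h (a i) / (\<Prod>j\<in>I - {i}. a i - a j)) (\<Prod>j\<in>I - {i}. [:- a j, 1:]))"
    (is "h = ?r")
proof (rule poly_eqI_degree[of "a ` I"])
  fix x assume "x \<in> a ` I"
  then obtain k where k: "k \<in> I" "x = a k" by auto
  have "poly ?r (a k) = (\<Sum>i\<in>I. if i = k then poly h (a k) else 0)"
    unfolding poly_sum
  proof (intro sum.cong refl)
    fix i assume i: "i \<in> I"
    show "poly (Polynomial.smult (poly h (a i) / (\<Prod>j\<in>I - {i}. a i - a j)) (\<Prod>j\<in>I - {i}. [:- a j, 1:])) (a k)
      = (if i = k then poly h (a k) else 0)"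
    proof (cases "i = k")
      case True
      have "(\<Prod>j\<in>I - {k}. a k - a j) \<noteq> 0"
        using fin inj k by (auto simp: inj_on_def)
      with True show ?thesis by (simp add: poly_prod)
    next
      case False
      then have "(\<Prod>j\<in>I - {i}. a k - a j) = 0"
        using fin k by (intro prod_zero) auto
      with False show ?thesis by (simp add: poly_prod)
    qed
  qed
  also have "\<dots> = poly h (a k)"
    using fin k by simp
  finally show "poly h x = poly ?r x" using k by simp
next
  show "degree h < card (a ` I)" using deg inj by (simp add: card_image)
  have "degree ?r \<le> card I - 1"
  proof (rule degree_sum_le[OF fin])
    fix i assume "i \<in> I"
    have "degree (\<Prod>j\<in>I - {i}. [:- a j, 1:]) \<le> (\<Sum>j\<in>I - {i}. degree [:- a j, 1:])"
      using degree_prod_sum_le[of "I - {i}" "\<lambda>j. [:- a j, 1:]"] fin by (simp add: o_def)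
    also have "\<dots> = card I - 1" using fin \<open>i \<in> I\<close> by simp
    finally show "degree (Polynomial.smult (poly h (a i) / (\<Prod>j\<in>I - {i}. a i - a j)) (\<Prod>j\<in>I - {i}. [:- a j, 1:])) \<le> card I - 1"
      using degree_smult_le order_trans by blast
  qed
  then show "degree ?r < card (a ` I)" using deg inj by (simp add: card_image)
qed

text \<open>Compare top coefficients in the Lagrange formula: each basis product is monic of degree
  \<open>card I - 1\<close>. For smaller degree of \<open>h\<close> this says that the residues of a
  partial fraction expansion sum to 0.\<close>

lemma divided_difference_poly:
  fixes h :: "'a::field poly"
  assumes fin: "finite I" and inj: "inj_on a I" and deg: "degree h < card I"
  shows "(\<Sum>i\<in>I. poly h (a i) / (\<Prod>j\<in>I - {i}. a i - a j)) = coeff h (card I - 1)"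
proof -
  have "coeff (\<Prod>j\<in>I - {i}. [:- a j, 1:]) (card I - 1) = 1" if "i \<in> I" for i
  proof -
    have "degree (\<Prod>j\<in>I - {i}. [:- a j, 1:]) = card I - 1"
      using fin that by (subst degree_prod_eq_sum_degree) auto
    moreover have "lead_coeff (\<Prod>j\<in>I - {i}. [:- a j, 1:]) = 1"
      by (simp add: lead_coeff_prod)
    ultimately show ?thesis by simp
  qed
  then show ?thesis
    by (subst (2) lagrange_identity[OF assms]) (simp add: coeff_sum)
qed

lemma divided_difference_power:
  fixes a :: "'b \<Rightarrow> 'a::field"
  assumes "finite I" "inj_on a I" "p < card I"
  shows "(\<Sum>i\<in>I. a i ^ p / (\<Prod>j\<in>I - {i}. a i - a j)) = (if Suc p = card I then 1 else 0)"
  using divided_difference_poly[of I a "monom 1 p"] assms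
  by (auto simp: degree_monom_eq poly_monom)

text \<open>Divide the Lagrange formula by the product over all nodes.\<close>

lemma partial_fractions:
  fixes h :: "'a::field poly"
  assumes fin: "finite I" and inj: "inj_on a I" and deg: "degree h < card I"
    and z: "\<And>i. i \<in> I \<Longrightarrow> z \<noteq> a i"
  shows "poly h z / (\<Prod>i\<in>I. z - a i) = (\<Sum>i\<in>I. poly h (a i) / (\<Prod>j\<in>I - {i}. a i - a j) / (z - a i))"
proof -
  have "poly h z / (\<Prod>i\<in>I. z - a i) =
      (\<Sum>i\<in>I. poly h (a i) / (\<Prod>j\<in>I - {i}. a i - a j) * (\<Prod>j\<in>I - {i}. z - a j) / (\<Prod>i\<in>I. z - a i))"
    by (subst (1) lagrange_identity[OF assms(1-3)])
       (simp add: poly_sum poly_prod sum_divide_distrib)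
  also have "\<dots> = (\<Sum>i\<in>I. poly h (a i) / (\<Prod>j\<in>I - {i}. a i - a j) / (z - a i))"
  proof (intro sum.cong refl)
    fix i assume i: "i \<in> I"
    have "(\<Prod>j\<in>I. z - a j) = (z - a i) * (\<Prod>j\<in>I - {i}. z - a j)"
      using fin i by (rule prod.remove)
    moreover have "(\<Prod>j\<in>I - {i}. z - a j) \<noteq> 0" using fin z by auto
    ultimately show "poly h (a i) / (\<Prod>j\<in>I - {i}. a i - a j) * (\<Prod>j\<in>I - {i}. z - a j) / (\<Prod>i\<in>I. z - a i)
       = poly h (a i) / (\<Prod>j\<in>I - {i}. a i - a j) / (z - a i)"
      by simp
  qed
  finally show ?thesis .
qed

text \<open>The divided difference of \<open>h\<close> at the points of \<open>X\<close>, in its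
  symmetric form: no enumeration of \<open>X\<close> enters.\<close>

definition divdiff :: "real set \<Rightarrow> (real \<Rightarrow> real) \<Rightarrow> real" where
  "divdiff X h = (\<Sum>x\<in>X. h x / (\<Prod>x'\<in>X - {x}. x - x'))"

lemma divdiff_power:
  assumes "finite X" "p < card X"
  shows "divdiff X (\<lambda>x. x ^ p) = (if Suc p = card X then 1 else 0)"
  using divided_difference_power[of X "\<lambda>x. x" p] assms by (simp add: divdiff_def)

text \<open>Row r of the matrix \<open>L\<close> is the functional taking h to the divided
  difference of x^r h. On falling powers it gives a lower triangular matrix with unit diagonal, so
  det \<open>L\<close> is the inverse of the Vandermonde determinant. In the mixed matrix the power
  columns then vanish in the first \<open>K\<close> rows, and their remaining block has determinant
  1, which leaves the \<open>K\<close> by \<open>K\<close> block of the functions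
  \<open>f c\<close>.\<close>

lemma fdet_divdiff:
  fixes xs :: "real list" and f :: "nat \<Rightarrow> real \<Rightarrow> real"
  assumes "distinct xs" "K \<le> length xs"
  shows "fdet (length xs) (\<lambda>i c. if c < K then f c (xs ! i) else xs ! i ^ (length xs - 1 - c))
    = vandermonde xs * fdet K (\<lambda>r c. divdiff (set xs) (\<lambda>x. x ^ r * f c x))"
proof -
  define n where "n = length xs"
  define X where "X = set xs"
  define L where "L = (\<lambda>r i. xs ! i ^ r / (\<Prod>x'\<in>X - {xs ! i}. xs ! i - x'))"
  have card: "finite X" "card X = n"
    using assms by (auto simp: X_def n_def distinct_card)
  have L_sum: "(\<Sum>i<n. L r i * g (xs ! i)) = divdiff X (\<lambda>x. x ^ r * g x)" for r g
    unfolding divdiff_def L_def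
    by (rule sum.reindex_bij_betw[of "\<lambda>i. xs ! i" "{..<n}" X, symmetric, THEN sym, THEN trans[rotated]])
       (use assms in \<open>auto simp: n_def X_def bij_betw_nth\<close>)
  have "fdet n L * vandermonde xs = fdet n (\<lambda>r c. divdiff X (\<lambda>x. x ^ (r + (n - 1 - c))))"
    unfolding vandermonde_det fdet_mult n_def[symmetric]
    by (rule fdet_cong, subst L_sum) (simp only: power_add)
  also have "\<dots> = (\<Prod>i<n. divdiff X (\<lambda>x. x ^ (i + (n - 1 - i))))"
    by (rule fdet_lower_triangular) (subst divdiff_power, use card in auto)
  also have "\<dots> = 1"
    by (intro prod.neutral ballI, subst divdiff_power) (use card in auto)
  finally have L: "vandermonde xs * fdet n L = 1" by (simp add: mult.commute)
  have "fdet n (\<lambda>i c. if c < K then f c (xs ! i) else xs ! i ^ (n - 1 - c)) = 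
     vandermonde xs * (fdet n L * fdet n (\<lambda>i c. if c < K then f c (xs ! i) else xs ! i ^ (n - 1 - c)))"
    using L by (simp add: mult.assoc[symmetric])
  also have "fdet n L * fdet n (\<lambda>i c. if c < K then f c (xs ! i) else xs ! i ^ (n - 1 - c)) =
     fdet n (\<lambda>r c. divdiff X (\<lambda>x. if c < K then x ^ r * f c x else x ^ (r + (n - 1 - c))))"
    unfolding fdet_mult
    by (rule fdet_cong, subst L_sum, rule arg_cong[where f = "divdiff X"], rule ext)
      (simp only: power_add if_distrib[where f = "(*) _"])
  also have "\<dots> = fdet (K + (n - K)) (\<lambda>r c. divdiff X (\<lambda>x. if c < K then x ^ r * f c x else x ^ (r + (n - 1 - c))))"
    using assms by (simp add: n_def)
  also have "\<dots> = fdet K (\<lambda>r c. divdiff X (\<lambda>x. if c < K then x ^ r * f c x else x ^ (r + (n - 1 - c)))) *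
     fdet (n - K) (\<lambda>r c. divdiff X (\<lambda>x. if K + c < K then x ^ (K + r) * f (K + c) x else x ^ (K + r + (n - 1 - (K + c)))))"
    by (rule fdet_block_upper_right_zero) (use card in \<open>auto simp: divdiff_power\<close>)
  also have "fdet (n - K) (\<lambda>r c. divdiff X (\<lambda>x. if K + c < K then x ^ (K + r) * f (K + c) x else x ^ (K + r + (n - 1 - (K + c))))) = 1"
    by (subst fdet_lower_triangular) (use card in \<open>auto simp: divdiff_power intro!: prod.neutral\<close>)
  also have "fdet K (\<lambda>r c. divdiff X (\<lambda>x. if c < K then x ^ r * f c x else x ^ (r + (n - 1 - c)))) =
     fdet K (\<lambda>r c. divdiff X (\<lambda>x. x ^ r * f c x))"
    by (rule fdet_cong) simp
  finally show ?thesis unfolding n_def X_def mult_1_right .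
qed

section \<open>Integrals over vertical lines\<close>

text \<open>Rescaling by \<open>\<alpha>\<close> reduces to the integral of 1/(1 + x^2). The
  Jacobian enters with its absolute value, which leaves the sign of \<open>\<alpha>\<close>.\<close>

lemma
  assumes "\<alpha> \<noteq> (0::real)"
  shows integrable_lorentzian: "integrable lborel (\<lambda>t. \<alpha> / (\<alpha>\<^sup>2 + t\<^sup>2))"
    and integral_lorentzian: "(LINT t|lborel. \<alpha> / (\<alpha>\<^sup>2 + t\<^sup>2)) = pi * sgn \<alpha>"
proof -
  define f :: "real \<Rightarrow> real" where "f = (\<lambda>x. inverse (1 + x\<^sup>2))"
  have int: "integrable lborel f"
    using integrable_inverse_1_plus_square by (simp add: set_integrable_def f_def)
  have val: "integral\<^sup>L lborel f = pi"
    using LBINT_inverse_1_plus_square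
    by (simp add: f_def interval_lebesgue_integral_def set_lebesgue_integral_def)
  have eq: "\<alpha> / (\<alpha>\<^sup>2 + t\<^sup>2) = f (0 + (1 / \<alpha>) * t) / \<alpha>" for t
  proof -
    have "1 + (1 / \<alpha> * t)\<^sup>2 = (\<alpha>\<^sup>2 + t\<^sup>2) / \<alpha>\<^sup>2"
      using assms by (simp add: power_mult_distrib power_divide add_divide_distrib)
    then show ?thesis
      using assms by (simp add: f_def power2_eq_square)
  qed
  have "integrable lborel (\<lambda>t. f (0 + (1 / \<alpha>) * t))"
    using int assms by (intro lborel_integrable_real_affine) auto
  then show "integrable lborel (\<lambda>t. \<alpha> / (\<alpha>\<^sup>2 + t\<^sup>2))"
    unfolding eq by simp
  have "pi = \<bar>1 / \<alpha>\<bar> * (LINT t|lborel. f (0 + (1 / \<alpha>) * t))"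
    using lborel_integral_real_affine[of "1 / \<alpha>" f 0] assms by (simp add: val)
  then show "(LINT t|lborel. \<alpha> / (\<alpha>\<^sup>2 + t\<^sup>2)) = pi * sgn \<alpha>"
    unfolding eq using assms by (simp add: field_simps sgn_if abs_if split: if_splits)
qed

lemma Complex_nonzero: "a \<noteq> 0 \<Longrightarrow> Complex a t \<noteq> 0"
  by (simp add: complex_eq_iff)

text \<open>One reciprocal decays only like 1/t, but the difference of two decays like 1/t^2.
  Averaging over t and -t keeps the real parts, which are Lorentzians.\<close>

lemma
  fixes \<alpha> \<beta> :: real
  assumes "\<alpha> \<noteq> 0" "\<beta> \<noteq> 0"
  defines "g \<equiv> \<lambda>t. 1 / Complex \<alpha> t - 1 / Complex \<beta> t"
  shows integrable_vline_difference: "integrable lborel g"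
    and integral_vline_difference: "integral\<^sup>L lborel g = of_real (pi * (sgn \<alpha> - sgn \<beta>))"
proof -
  have nz: "Complex \<alpha> t \<noteq> 0" "Complex \<beta> t \<noteq> 0" for t
    using assms Complex_nonzero by auto
  have cont: "continuous_on UNIV (\<lambda>t. Complex a t)" for a
    unfolding Complex_eq by (intro continuous_intros)
  have meas: "g \<in> borel_measurable lborel"
    unfolding g_def by (simp, intro borel_measurable_continuous_onI continuous_intros cont) (use nz in auto)
  \<comment> \<open>The majorant comes from ab \<le> a^2 + b^2 for the moduli of the two
    reciprocals; each square is written as a multiple of a Lorentzian.\<close>
  have bound: "integrable lborel (\<lambda>t. \<bar>\<beta> - \<alpha>\<bar> * (1 / \<alpha> * (\<alpha> / (\<alpha>\<^sup>2 + t\<^sup>2)) + 1 / \<beta> * (\<beta> / (\<beta>\<^sup>2 + t\<^sup>2))))"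
    by (intro integrable_mult_right Bochner_Integration.integrable_add integrable_lorentzian assms)
  show int: "integrable lborel g"
  proof (rule Bochner_Integration.integrable_bound[OF bound meas], intro AE_I2)
    fix t
    define A B where "A = norm (Complex \<alpha> t)" and "B = norm (Complex \<beta> t)"
    have AB: "A > 0" "B > 0" "A\<^sup>2 = \<alpha>\<^sup>2 + t\<^sup>2" "B\<^sup>2 = \<beta>\<^sup>2 + t\<^sup>2"
      using nz assms by (auto simp: A_def B_def cmod_def sum_power2_gt_zero_iff)
    have "g t = of_real (\<beta> - \<alpha>) / (Complex \<alpha> t * Complex \<beta> t)"
    proof -
      have "Complex \<beta> t - Complex \<alpha> t = of_real (\<beta> - \<alpha>)"
        by (simp add: complex_eq_iff)
      then show ?thesis
        using nz[of t] by (simp add: g_def diff_frac_eq)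
    qed
    then have "norm (g t) = \<bar>\<beta> - \<alpha>\<bar> / (A * B)"
      by (simp only: norm_divide norm_mult norm_of_real A_def B_def)
    then have "norm (g t) = \<bar>\<beta> - \<alpha>\<bar> * (1 / A * (1 / B))" by simp
    also have "\<dots> \<le> \<bar>\<beta> - \<alpha>\<bar> * ((1 / A)\<^sup>2 + (1 / B)\<^sup>2)"
    proof (rule mult_left_mono)
      have "0 \<le> 1 / A * (1 / B)" using AB by auto
      then show "1 / A * (1 / B) \<le> (1 / A)\<^sup>2 + (1 / B)\<^sup>2"
        using sum_squares_bound[of "1 / A" "1 / B"] by linarith
    qed simp
    also have "\<dots> = \<bar>\<beta> - \<alpha>\<bar> * (1 / \<alpha> * (\<alpha> / (\<alpha>\<^sup>2 + t\<^sup>2)) + 1 / \<beta> * (\<beta> / (\<beta>\<^sup>2 + t\<^sup>2)))"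
      using assms AB by (simp add: power_divide)
    finally show "norm (g t) \<le> norm (\<bar>\<beta> - \<alpha>\<bar> * (1 / \<alpha> * (\<alpha> / (\<alpha>\<^sup>2 + t\<^sup>2)) + 1 / \<beta> * (\<beta> / (\<beta>\<^sup>2 + t\<^sup>2))))"
      by simp
  qed
  have refl: "integral\<^sup>L lborel g = (LINT t|lborel. g (- t))"
    using lborel_integral_real_affine[of "-1" g 0] by simp
  have int': "integrable lborel (\<lambda>t. g (- t))"
    using lborel_integrable_real_affine[OF int, of "-1" 0] by simp
  have symm: "g t + g (- t) = of_real (2 * (\<alpha> / (\<alpha>\<^sup>2 + t\<^sup>2)) - 2 * (\<beta> / (\<beta>\<^sup>2 + t\<^sup>2)))" for t
    by (simp add: g_def complex_eq_iff Re_divide Im_divide power2_eq_square)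
  have "2 * integral\<^sup>L lborel g = (LINT t|lborel. g t + g (- t))"
    using int int' refl by simp
  also have "\<dots> = of_real (LINT t|lborel. 2 * (\<alpha> / (\<alpha>\<^sup>2 + t\<^sup>2)) - 2 * (\<beta> / (\<beta>\<^sup>2 + t\<^sup>2)))"
    unfolding symm by (rule integral_complex_of_real)
  also have "(LINT t|lborel. 2 * (\<alpha> / (\<alpha>\<^sup>2 + t\<^sup>2)) - 2 * (\<beta> / (\<beta>\<^sup>2 + t\<^sup>2))) = 2 * (pi * sgn \<alpha>) - 2 * (pi * sgn \<beta>)"
    using assms
    by (simp only: Bochner_Integration.integral_diff integrable_mult_right integrable_lorentzian
        integral_mult_right_zero integral_lorentzian not_False_eq_True)
  also have "complex_of_real \<dots> = 2 * of_real (pi * (sgn \<alpha> - sgn \<beta>))"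
    by (simp add: algebra_simps)
  finally show "integral\<^sup>L lborel g = of_real (pi * (sgn \<alpha> - sgn \<beta>))"
    by simp
qed

text \<open>The degree bound makes the residues \<open>r x\<close> sum to 0, so 1/z can be
  subtracted from every partial fraction 1/(z - x). Each term is then a difference as in
  \<open>integral_vline_difference\<close>, with the pole at 0 as common reference.\<close>

lemma
  fixes h :: "complex poly" and X :: "real set" and c :: real
  assumes fin: "finite X" and deg: "Suc (degree h) < card X" and c: "c \<noteq> 0" "c \<notin> X"
  defines "R \<equiv> \<lambda>t. poly h (Complex c t) / (\<Prod>x\<in>X. Complex c t - of_real x)"
  shows integrable_vline_rational: "integrable lborel R"
    and integral_vline_rational: "integral\<^sup>L lborel R =
      (\<Sum>x\<in>X. poly h (of_real x) / (\<Prod>x'\<in>X - {x}. of_real x - of_real x') * of_real (pi * (sgn (c - x) - sgn c)))"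
proof -
  define r where "r = (\<lambda>x. poly h (of_real x) / (\<Prod>x'\<in>X - {x}. complex_of_real x - of_real x'))"
  have inj: "inj_on complex_of_real X" by (simp add: inj_on_def)
  have deg': "degree h < card X" using deg by simp
  have "(\<Sum>x\<in>X. r x) = 0"
    unfolding r_def divided_difference_poly[OF fin inj deg'] using deg by (intro coeff_eq_0) auto
  then have r0: "(\<Sum>x\<in>X. r x * s) = 0" for s
    by (simp add: sum_distrib_right[symmetric])
  have sub: "Complex c t - of_real x = Complex (c - x) t" for x t
    by (simp add: complex_eq_iff)
  have R: "R t = (\<Sum>x\<in>X. r x * (1 / Complex (c - x) t - 1 / Complex c t))" for t
  proof -
    have "R t = (\<Sum>x\<in>X. r x / (Complex c t - of_real x))"
      unfolding R_def r_def
      by (rule partial_fractions[OF fin inj deg']) (use c in \<open>auto simp: complex_eq_iff\<close>)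
    also have "\<dots> = (\<Sum>x\<in>X. r x / Complex (c - x) t) - (\<Sum>x\<in>X. r x * (1 / Complex c t))"
      unfolding r0 sub by simp
    finally show ?thesis
      by (simp add: sum_subtractf[symmetric] algebra_simps)
  qed
  have nz: "c - x \<noteq> 0" if "x \<in> X" for x using that c by auto
  show "integrable lborel R"
    unfolding R using nz c
    by (intro Bochner_Integration.integrable_sum integrable_mult_right integrable_vline_difference) auto
  have "integral\<^sup>L lborel R = (\<Sum>x\<in>X. LINT t|lborel. r x * (1 / Complex (c - x) t - 1 / Complex c t))"
    unfolding R using nz c
    by (intro Bochner_Integration.integral_sum integrable_mult_right integrable_vline_difference) auto
  also have "\<dots> = (\<Sum>x\<in>X. r x * of_real (pi * (sgn (c - x) - sgn c)))"
    using nz c by (intro sum.cong refl) (simp only: integral_mult_right_zero integral_vline_difference not_False_eq_True)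
  finally show "integral\<^sup>L lborel R = (\<Sum>x\<in>X. poly h (of_real x) / (\<Prod>x'\<in>X - {x}. of_real x - of_real x') * of_real (pi * (sgn (c - x) - sgn c)))"
    by (simp add: r_def)
qed

section \<open>Truncated products as integrals over one vertical line\<close>

definition qnodes :: "'a::comm_ring_1 \<Rightarrow> nat \<Rightarrow> 'a \<Rightarrow> 'a \<Rightarrow> 'a" where
  "qnodes q m y x = (\<Prod>i<m. x - y * q ^ Suc i)"

text \<open>With \<open>m = N - K - 1\<close> this is the function f_y of the overview. Truncation
  and sign come from the contour: -(sgn (c - x) - sgn c)/2 is 1 for x > c > 0, -1 for x < c < 0, and
  0 for x on the same side of c as the origin.\<close>

definition qspline :: "real \<Rightarrow> nat \<Rightarrow> real \<Rightarrow> real \<Rightarrow> real" where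
  "qspline q m y x =
     (if y > 0 then (if y \<le> x then qnodes q m y x else 0)
      else (if x \<le> y then - qnodes q m y x else 0))"

lemma qpoch_inverse:
  fixes z :: "'a::field"
  assumes "z \<noteq> 0"
  shows "qpoch (y * inverse z * q) q m = qnodes q m y z / z ^ m"
proof -
  have "qpoch (y * inverse z * q) q m = (\<Prod>i<m. (z - y * q ^ Suc i) / z)"
    unfolding qpoch_def using assms by (intro prod.cong refl) (simp add: field_simps)
  then show ?thesis by (simp add: qnodes_def prod_dividef)
qed

text \<open>After clearing the powers of z the integrand is x^k times the nodal product, evaluated
  at z, over the product of all z - x. Its numerator has degree at most \<open>k + m\<close>, which
  is at most \<open>card X - 2\<close> because k < K, so \<open>integral_vline_rational\<close>
  applies. The contour enters only through the points of \<open>X\<close> beyond it.\<close>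

lemma
  fixes X :: "real set" and c y q :: real and k K :: nat
  assumes fin: "finite X" and k: "k < K" "K < card X" and c: "c \<noteq> 0" "c \<notin> X"
    and side: "y > 0 \<and> c > 0 \<and> (\<forall>x\<in>X. c < x \<longleftrightarrow> y \<le> x) \<or> y < 0 \<and> c < 0 \<and> (\<forall>x\<in>X. x < c \<longleftrightarrow> x \<le> y)"
  defines "m \<equiv> card X - K - 1"
  defines "w \<equiv> \<lambda>z. inverse z ^ (K - 1 - k) *
      (qpoch (complex_of_real y * inverse z * of_real q) (of_real q) m /
       (\<Prod>x\<in>X. 1 - of_real x * inverse z) * (1 / z\<^sup>2))"
  shows integrable_vline_weight: "integrable lborel (\<lambda>t. w (Complex c t))"
    and vline_integral_weight:
      "vline_integral c w = 2 * of_real pi * \<i> * of_real (divdiff X (\<lambda>x. x ^ k * qspline q m y x))"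
proof -
  define h where "h = monom 1 k * (\<Prod>i<m. [:- (of_real y * of_real q ^ Suc i), 1 :: complex:])"
  have poly_h: "poly h z = z ^ k * qnodes (of_real q) m (of_real y) z" for z
    by (simp add: h_def poly_monom poly_prod qnodes_def)
  have "degree (\<Prod>i<m. [:- (of_real y * of_real q ^ Suc i), 1 :: complex:]) \<le> m"
    using degree_prod_sum_le[of "{..<m}" "\<lambda>i. [:- (of_real y * of_real q ^ Suc i), 1 :: complex:]"]
    by (simp add: o_def)
  then have "degree h \<le> k + m"
    unfolding h_def by (metis add_mono degree_monom_le degree_mult_le order_trans)
  then have deg: "Suc (degree h) < card X" using k by (simp add: m_def)
  have w: "w (Complex c t) = poly h (Complex c t) / (\<Prod>x\<in>X. Complex c t - of_real x)" for t
  proof -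
    define z where "z = Complex c t"
    have z: "z \<noteq> 0" using c Complex_nonzero by (simp add: z_def)
    define P where "P = (\<Prod>x\<in>X. z - of_real x)"
    have "z - of_real x \<noteq> 0" if "x \<in> X" for x
      using that c by (auto simp: z_def complex_eq_iff)
    then have P: "P \<noteq> 0"
      using fin by (simp add: P_def)
    have "(\<Prod>x\<in>X. 1 - of_real x * inverse z) = (\<Prod>x\<in>X. (z - of_real x) / z)"
      using z by (intro prod.cong refl) (simp add: field_simps)
    also have "\<dots> = P / z ^ card X"
      by (simp add: prod_dividef P_def)
    \<comment> \<open>The negative powers of z are \<open>K - 1 - k\<close> from the Vandermonde
      entry, \<open>m\<close> from the Pochhammer symbol and 2 from dz/z^2. The product over
      \<open>X\<close> contributes z to the power \<open>card X\<close>, so z^k is left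
      over.\<close>
    also have "card X = (K - 1 - k) + m + 2 + k"
      using k by (simp add: m_def)
    finally have Q: "(\<Prod>x\<in>X. 1 - of_real x * inverse z) = P / (z ^ (K - 1 - k) * z ^ m * z ^ 2 * z ^ k)"
      by (simp only: power_add)
    show ?thesis
      unfolding w_def z_def[symmetric] poly_h qpoch_inverse[OF z] Q P_def[symmetric] using z P
      by (simp add: field_simps)
  qed
  show "integrable lborel (\<lambda>t. w (Complex c t))"
    unfolding w by (rule integrable_vline_rational[OF fin deg c])
  have qn: "qnodes (of_real q) m (of_real y) (complex_of_real x) = of_real (qnodes q m y x)" for x
    by (simp add: qnodes_def)
  have "vline_integral c w = (\<Sum>x\<in>X. - \<i> * (poly h (of_real x) / (\<Prod>x'\<in>X - {x}. of_real x - of_real x') * of_real (pi * (sgn (c - x) - sgn c))))"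
    unfolding vline_integral_def w integral_vline_rational[OF fin deg c] sum_distrib_left ..
  also have "\<dots> = (\<Sum>x\<in>X. 2 * of_real pi * \<i> * of_real (x ^ k * qspline q m y x / (\<Prod>x'\<in>X - {x}. x - x')))"
  proof (intro sum.cong refl)
    fix x assume x: "x \<in> X"
    \<comment> \<open>The factor -2 here and the factor \<open>- \<i>\<close> of the downward
      orientation combine with pi to 2 pi i.\<close>
    have "(sgn (c - x) - sgn c) * qnodes q m y x = - 2 * qspline q m y x"
    proof -
      have xc: "x \<noteq> c" using x c by auto
      from side show ?thesis
      proof
        assume *: "y > 0 \<and> c > 0 \<and> (\<forall>x\<in>X. c < x \<longleftrightarrow> y \<le> x)"
        then have "c < x \<longleftrightarrow> y \<le> x" using x by blast
        then show ?thesis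
          using * xc by (cases "y \<le> x") (simp_all add: qspline_def)
      next
        assume *: "y < 0 \<and> c < 0 \<and> (\<forall>x\<in>X. x < c \<longleftrightarrow> x \<le> y)"
        then have "x < c \<longleftrightarrow> x \<le> y" using x by blast
        then show ?thesis
          using * xc by (cases "x \<le> y") (simp_all add: qspline_def)
      qed
    qed
    then have "of_real (sgn (c - x) - sgn c) * complex_of_real (qnodes q m y x) = of_real (- 2 * qspline q m y x)"
      by (metis of_real_mult)
    then show "- \<i> * (poly h (of_real x) / (\<Prod>x'\<in>X - {x}. of_real x - of_real x') * of_real (pi * (sgn (c - x) - sgn c)))
      = 2 * of_real pi * \<i> * of_real (x ^ k * qspline q m y x / (\<Prod>x'\<in>X - {x}. x - x'))"
      by (simp add: poly_h qn mult_ac)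
  qed
  finally show "vline_integral c w = 2 * of_real pi * \<i> * of_real (divdiff X (\<lambda>x. x ^ k * qspline q m y x))"
    by (simp add: divdiff_def sum_distrib_left)
qed

section \<open>Iterated integrals of determinants\<close>

lemma iterated_vline_integral_cong:
  assumes "\<And>zs. length zs = length cs \<Longrightarrow> (\<And>j. j < length cs \<Longrightarrow> Re (zs ! j) = cs ! j) \<Longrightarrow> f zs = g zs"
  shows "iterated_vline_integral cs f = iterated_vline_integral cs g"
  using assms
proof (induction cs arbitrary: f g)
  case Nil
  then show ?case by simp
next
  case (Cons c cs)
  have "iterated_vline_integral cs (\<lambda>zs. f (Complex c t # zs)) = iterated_vline_integral cs (\<lambda>zs. g (Complex c t # zs))" for t
    by (rule Cons.IH, rule Cons.prems) (auto simp: nth_Cons split: nat.splits)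
  then show ?case by (simp add: vline_integral_def)
qed

text \<open>The factor of the first variable is a constant for the inner integrals, so it is
  absorbed into the coefficient; this is why the induction varies \<open>s\<close> and
  \<open>g\<close>. Only integrals in one variable remain.\<close>

lemma iterated_vline_integral_product_sum:
  assumes "finite P"
    and "\<And>p j. p \<in> P \<Longrightarrow> j < length cs \<Longrightarrow> integrable lborel (\<lambda>t. g p j (Complex (cs ! j) t))"
  shows "iterated_vline_integral cs (\<lambda>zs. \<Sum>p\<in>P. s p * (\<Prod>j<length cs. g p j (zs ! j)))
    = (\<Sum>p\<in>P. s p * (\<Prod>j<length cs. vline_integral (cs ! j) (g p j)))"
  using assms(2)
proof (induction cs arbitrary: s g)
  case Nil
  then show ?case by simp
next
  case (Cons c cs)
  have int: "integrable lborel (\<lambda>t. g p 0 (Complex c t))" if "p \<in> P" for p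
    using Cons.prems[OF that, of 0] by simp
  have "iterated_vline_integral (c # cs) (\<lambda>zs. \<Sum>p\<in>P. s p * (\<Prod>j<length (c # cs). g p j (zs ! j)))
     = vline_integral c (\<lambda>z. iterated_vline_integral cs
         (\<lambda>zs. \<Sum>p\<in>P. (s p * g p 0 z) * (\<Prod>j<length cs. g p (Suc j) (zs ! j))))"
    by (simp add: prod.lessThan_Suc_shift mult.assoc del: prod.lessThan_Suc)
  also have "\<dots> = vline_integral c (\<lambda>z. \<Sum>p\<in>P. (s p * g p 0 z) * (\<Prod>j<length cs. vline_integral (cs ! j) (g p (Suc j))))"
    by (subst Cons.IH) (use Cons.prems[of _ "Suc _"] in auto)
  also have "\<dots> = (\<Sum>p\<in>P. s p * vline_integral c (g p 0) * (\<Prod>j<length cs. vline_integral (cs ! j) (g p (Suc j))))"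
    unfolding vline_integral_def using int
    by (subst Bochner_Integration.integral_sum) (auto simp: sum_distrib_left mult_ac intro!: sum.cong)
  finally show ?case
    by (simp add: prod.lessThan_Suc_shift mult.assoc del: prod.lessThan_Suc)
qed

text \<open>Row j of the Vandermonde determinant in the inverses depends on z_j alone. In the
  Leibniz expansion every term is therefore a product of functions of single variables.\<close>

lemma iterated_vline_integral_det:
  assumes len: "length cs = K"
    and int: "\<And>j k. j < K \<Longrightarrow> k < K \<Longrightarrow>
      integrable lborel (\<lambda>t. inverse (Complex (cs ! j) t) ^ (K - 1 - k) * w j (Complex (cs ! j) t))"
  shows "iterated_vline_integral cs (\<lambda>zs. vandermonde (map inverse zs) * (\<Prod>j<K. w j (zs ! j)))
    = fdet K (\<lambda>j k. vline_integral (cs ! j) (\<lambda>z. inverse z ^ (K - 1 - k) * w j z))"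
proof -
  have "iterated_vline_integral cs (\<lambda>zs. vandermonde (map inverse zs) * (\<Prod>j<K. w j (zs ! j)))
     = iterated_vline_integral cs (\<lambda>zs. \<Sum>p | p permutes {..<K}. signof p * (\<Prod>j<length cs. inverse (zs ! j) ^ (K - 1 - p j) * w j (zs ! j)))"
  proof (rule iterated_vline_integral_cong)
    fix zs :: "complex list" assume zs: "length zs = length cs"
    have "vandermonde (map inverse zs) = fdet K (\<lambda>j k. map inverse zs ! j ^ (K - 1 - k))"
      using zs len by (simp add: vandermonde_det)
    also have "\<dots> = (\<Sum>p | p permutes {..<K}. signof p * (\<Prod>j<K. inverse (zs ! j) ^ (K - 1 - p j)))"
      unfolding fdet_Leibniz using zs len by (intro sum.cong refl arg_cong2[where f = "(*)"] prod.cong) auto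
    finally show "vandermonde (map inverse zs) * (\<Prod>j<K. w j (zs ! j)) =
        (\<Sum>p | p permutes {..<K}. signof p * (\<Prod>j<length cs. inverse (zs ! j) ^ (K - 1 - p j) * w j (zs ! j)))"
      by (simp add: len sum_distrib_right prod.distrib mult.assoc)
  qed
  also have "\<dots> = (\<Sum>p | p permutes {..<K}. signof p * (\<Prod>j<length cs. vline_integral (cs ! j) (\<lambda>z. inverse z ^ (K - 1 - p j) * w j z)))"
    using len int
    by (intro iterated_vline_integral_product_sum)
       (auto simp: finite_permutations dest: permutes_in_image)
  finally show ?thesis
    unfolding fdet_Leibniz by (simp add: len)
qed

text \<open>The entry with inverse power \<open>K - 1 - k\<close> integrates to the divided
  difference with x^k. The final transposition makes the power the row index, as in
  \<open>fdet_divdiff\<close>.\<close>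

lemma iterated_vline_integral_splines:
  fixes X :: "real set" and ys cs :: "real list" and q :: real
  assumes fin: "finite X" and K: "K < card X" "length ys = K" "length cs = K"
    and c: "\<And>j. j < K \<Longrightarrow> cs ! j \<notin> X"
    and side: "\<And>j. j < K \<Longrightarrow> ys ! j > 0 \<and> cs ! j > 0 \<and> (\<forall>x\<in>X. cs ! j < x \<longleftrightarrow> ys ! j \<le> x) \<or>
       ys ! j < 0 \<and> cs ! j < 0 \<and> (\<forall>x\<in>X. x < cs ! j \<longleftrightarrow> x \<le> ys ! j)"
  shows "iterated_vline_integral cs (\<lambda>zs.
      vandermonde (map inverse zs) *
      (\<Prod>j<K.
        qpoch (complex_of_real (ys ! j) * inverse (zs ! j) * complex_of_real q) (complex_of_real q) (card X - K - 1) /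
        (\<Prod>x\<in>X. 1 - complex_of_real x * inverse (zs ! j)) *
        (1 / (zs ! j)\<^sup>2))) =
    (2 * of_real pi * \<i>) ^ K *
    of_real (fdet K (\<lambda>r c. divdiff X (\<lambda>x. x ^ r * qspline q (card X - K - 1) (ys ! c) x)))"
proof -
  define w where "w = (\<lambda>j z. qpoch (complex_of_real (ys ! j) * inverse z * complex_of_real q) (complex_of_real q) (card X - K - 1) /
        (\<Prod>x\<in>X. 1 - complex_of_real x * inverse z) * (1 / z\<^sup>2))"
  define M where "M = (\<lambda>j k. divdiff X (\<lambda>x. x ^ k * qspline q (card X - K - 1) (ys ! j) x))"
  have c0: "cs ! j \<noteq> 0" if "j < K" for j using side[OF that] by auto
  have "iterated_vline_integral cs (\<lambda>zs. vandermonde (map inverse zs) * (\<Prod>j<K. w j (zs ! j)))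
    = fdet K (\<lambda>j k. vline_integral (cs ! j) (\<lambda>z. inverse z ^ (K - 1 - k) * w j z))"
    unfolding w_def
    using fin K c c0 side by (intro iterated_vline_integral_det integrable_vline_weight) auto
  also have "\<dots> = fdet K (\<lambda>j k. 2 * of_real pi * \<i> * of_real (M j k))"
    unfolding w_def M_def
    using fin K c c0 side by (intro fdet_cong vline_integral_weight) auto
  also have "\<dots> = (2 * of_real pi * \<i>) ^ K * fdet K (\<lambda>j k. of_real (M j k))"
    using fdet_scale_rows[of K "\<lambda>_. 2 * of_real pi * \<i>" "\<lambda>j k. of_real (M j k)"] by simp
  also have "fdet K (\<lambda>j k. complex_of_real (M j k)) = of_real (fdet K M)"
    unfolding fdet_Leibniz by (simp add: sign_def)
  also have "fdet K M = fdet K (\<lambda>r c. M c r)"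
    by (rule fdet_transpose[symmetric])
  finally show ?thesis by (simp add: w_def M_def)
qed

section \<open>The lattice and \<open>q\<close>-antiderivatives\<close>

text \<open>Replacing x by xq shifts the nodes by one step, so both products contain
  \<open>qnodes q m y x\<close>. The remaining linear factors differ by (x - y q^(m+1)) - q^(m+1) (x
  - y) = (1 - q^(m+1)) x.\<close>

lemma qnodes_Suc_diff:
  fixes q :: "'a::comm_ring_1"
  shows "qnodes q (Suc m) y x - qnodes q (Suc m) y (x * q) = (1 - q ^ Suc m) * x * qnodes q m y x"
proof -
  have "qnodes q (Suc m) y (x * q) = (\<Prod>i<Suc m. q * (x - y * q ^ i))"
    unfolding qnodes_def by (intro prod.cong refl) (simp add: algebra_simps)
  also have "\<dots> = q ^ Suc m * ((x - y) * (\<Prod>i<m. x - y * q ^ Suc i))"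
    by (subst prod.distrib) (simp add: prod.lessThan_Suc_shift del: prod.lessThan_Suc power_Suc)
  finally show ?thesis
    by (simp add: qnodes_def algebra_simps)
qed

locale qlattice_params =
  fixes q zp zm :: real
  assumes q: "0 < q" "q < 1" and zp: "0 < zp" and zm: "zm < 0"
begin

abbreviation L where "L \<equiv> qlattice q zp zm"
abbreviation I where "I \<equiv> qinterval q zp zm"

lemma L_nonzero: "x \<in> L \<Longrightarrow> x \<noteq> 0"
  using q zp zm by (auto simp: qlattice_def)

lemma powi_strict_anti: "m < n \<Longrightarrow> q powi n < q powi m" for m n :: int
  using q by (intro power_int_strict_decreasing)

lemma L_same_sign:
  assumes "x \<in> L" "y \<in> L" "0 < x * y"
  obtains n :: int where "y = x * q powi n"
proof -
  obtain a b and m n :: int where x: "x = a * q powi m" "a = zp \<or> a = zm"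
    and y: "y = b * q powi n" "b = zp \<or> b = zm"
    using assms by (auto simp: qlattice_def)
  have "q powi m > 0" "q powi n > 0" using q by simp_all
  then have "a = b" using assms(3) x y zp zm
    by (auto simp: zero_less_mult_iff mult_less_0_iff)
  then have "y = x * q powi (n - m)"
    using x y q by (simp add: power_int_diff)
  then show ?thesis using that by blast
qed

lemma L_scale: "x \<in> L \<Longrightarrow> x * q ^ n \<in> L"
proof -
  assume "x \<in> L"
  then obtain a and m :: int where x: "x = a * q powi m" "a = zp \<or> a = zm"
    by (auto simp: qlattice_def)
  then have "x * q ^ n = a * q powi (m + int n)"
    using q by (simp add: power_int_add)
  then show "x * q ^ n \<in> L"
    using x by (auto simp: qlattice_def)
qed

text \<open>On one side of 0 the ratio of two lattice points is an integer power of
  \<open>q\<close>; a ratio below 1 is thus at most \<open>q\<close>.\<close>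

lemma L_between:
  assumes "x \<in> L" "y \<in> L" "0 < x * y" "\<bar>x\<bar> < \<bar>y\<bar>"
  shows "\<bar>x\<bar> \<le> \<bar>y\<bar> * q"
proof -
  obtain n where n: "x = y * q powi n" using assms L_same_sign[of y x] by (auto simp: mult.commute)
  have "\<bar>y\<bar> * q powi n < \<bar>y\<bar> * q powi 0" using assms q n by (simp add: abs_mult)
  then have "q powi n < q powi 0"
    by (rule mult_left_less_imp_less) simp
  then have "n \<ge> 1" using powi_strict_anti[of n 0] powi_strict_anti[of 0 n] by (cases n "0::int" rule: linorder_cases) auto
  then have "q powi n \<le> q powi 1"
    using q by (intro power_int_decreasing) auto
  then show ?thesis using n q by (simp add: abs_mult mult_left_mono)
qed

section \<open>Telescoping sums over lattice intervals\<close>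

definition qtail :: "real \<Rightarrow> real set" where
  "qtail x = range (\<lambda>n::nat. x * q ^ n)"

lemma qtail_eq:
  assumes "x \<in> L"
  shows "qtail x = {z \<in> L. 0 < z * x \<and> \<bar>z\<bar> \<le> \<bar>x\<bar>}"
proof (intro equalityI subsetI)
  fix z assume "z \<in> qtail x"
  then obtain n where z: "z = x * q ^ n" by (auto simp: qtail_def)
  have "q ^ n \<le> 1" using q by (simp add: power_le_one)
  then show "z \<in> {z \<in> L. 0 < z * x \<and> \<bar>z\<bar> \<le> \<bar>x\<bar>}"
    using z assms q L_scale L_nonzero[OF assms]
    by (auto simp: abs_mult zero_less_mult_iff mult_less_0_iff mult_left_le)
next
  fix z assume z: "z \<in> {z \<in> L. 0 < z * x \<and> \<bar>z\<bar> \<le> \<bar>x\<bar>}"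
  then obtain n where n: "z = x * q powi n"
    using assms L_same_sign[of x z] by (auto simp: mult.commute)
  have "q powi n \<le> q powi 0"
    using z n q L_nonzero[OF assms] by (simp add: abs_mult)
  then have "n \<ge> 0" using powi_strict_anti[of n 0] by force
  then have "q powi n = q ^ nat n" by (simp add: power_int_def)
  then show "z \<in> qtail x" using n by (auto simp: qtail_def)
qed

text \<open>The factor x in the difference equation matches the weight |z| of the kernel. The limit
  0 at the origin fixes the constant on both half-lines, so that sums across 0 also telescope;
  boundedness of \<open>g\<close> gives absolute convergence.\<close>

definition q_antiderivative :: "(real \<Rightarrow> real) \<Rightarrow> (real \<Rightarrow> real) \<Rightarrow> bool" where
  "q_antiderivative G g \<longleftrightarrow> (\<forall>x\<in>L. G x - G (x * q) = x * g x \<and> (\<lambda>n. G (x * q ^ n)) \<longlonglongrightarrow> 0 \<and> Bseq (\<lambda>n. g (x * q ^ n)))"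

text \<open>The terms are \<open>sgn x\<close> times consecutive differences of \<open>G\<close>
  along x, xq, xq^2, ... A geometric majorant makes the telescoping series absolutely convergent,
  hence an unordered sum.\<close>

lemma qtail_has_sum:
  assumes "q_antiderivative G g" "x \<in> L"
  shows "((\<lambda>z. \<bar>z\<bar> * g z) has_sum (sgn x * G x)) (qtail x)"
proof -
  have inj: "inj (\<lambda>n::nat. x * q ^ n)"
    using q L_nonzero[OF assms(2)] by (auto intro!: injI simp: power_inject_exp')
  have lim: "(\<lambda>n. G (x * q ^ n)) \<longlonglongrightarrow> 0" and bs: "Bseq (\<lambda>n. g (x * q ^ n))"
    using assms by (auto simp: q_antiderivative_def)
  have step: "\<bar>x * q ^ n\<bar> * g (x * q ^ n) = sgn x * (G (x * q ^ n) - G (x * q ^ Suc n))" for n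
  proof -
    have "G (x * q ^ n) - G (x * q ^ Suc n) = x * q ^ n * g (x * q ^ n)"
      using assms(1) L_scale[OF assms(2), of n] by (auto simp: q_antiderivative_def mult_ac)
    moreover have "\<bar>x * q ^ n\<bar> = sgn x * (x * q ^ n)"
      using q by (auto simp: abs_mult sgn_if)
    ultimately show ?thesis by simp
  qed
  have sums: "(\<lambda>n. \<bar>x * q ^ n\<bar> * g (x * q ^ n)) sums (sgn x * (G x - 0))"
    unfolding step using telescope_sums'[OF lim] by (intro sums_mult) simp
  obtain C where C: "\<And>n. norm (g (x * q ^ n)) \<le> C"
    using BseqD[OF bs] by blast
  have "summable (\<lambda>n. norm (\<bar>x * q ^ n\<bar> * g (x * q ^ n)))"
  proof (rule summable_comparison_test')
    show "summable (\<lambda>n. \<bar>x\<bar> * C * q ^ n)"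
      using q by (intro summable_mult summable_geometric) auto
    show "norm (norm (\<bar>x * q ^ n\<bar> * g (x * q ^ n))) \<le> \<bar>x\<bar> * C * q ^ n" if "n \<ge> 0" for n
    proof -
      have "\<bar>x * q ^ n\<bar> * norm (g (x * q ^ n)) \<le> \<bar>x * q ^ n\<bar> * C"
        using C by (intro mult_left_mono) auto
      then show ?thesis using q by (simp add: abs_mult mult_ac)
    qed
  qed
  then have "((\<lambda>n. \<bar>x * q ^ n\<bar> * g (x * q ^ n)) has_sum (sgn x * (G x - 0))) UNIV"
    using sums by (rule norm_summable_imp_has_sum)
  then have "(((\<lambda>z. \<bar>z\<bar> * g z) \<circ> (\<lambda>n. x * q ^ n)) has_sum (sgn x * G x)) UNIV"
    by (simp add: o_def)
  then show ?thesis
    unfolding qtail_def by (subst has_sum_reindex) (use inj in auto)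
qed

text \<open>The conventions at the ends of I(a, b) make it a difference of two tails when a and b
  have equal sign, and their disjoint union when a < 0 < b. The signs in
  \<open>qtail_has_sum\<close> give the same expression in all three cases.\<close>

lemma I_has_sum:
  assumes "q_antiderivative G g" "a \<in> L" "b \<in> L" "a < b"
  shows "((\<lambda>z. \<bar>z\<bar> * g z) has_sum (G b - G a)) (I a b)"
proof -
  note ta = qtail_has_sum[OF assms(1,2)] and tb = qtail_has_sum[OF assms(1,3)]
  have nz: "a \<noteq> 0" "b \<noteq> 0" using assms L_nonzero by auto
  consider "0 < a" | "b < 0" | "a < 0" "0 < b" using nz by linarith
  then show ?thesis
  proof cases
    case 1
    then have "I a b = qtail b - qtail a" "qtail a \<subseteq> qtail b"
      using assms by (auto simp: qtail_eq qinterval_def zero_less_mult_iff)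
    then show ?thesis using has_sum_Diff[OF tb ta] 1 assms(4) by simp
  next
    case 2
    then have "I a b = qtail a - qtail b" "qtail b \<subseteq> qtail a"
      using assms by (auto simp: qtail_eq qinterval_def zero_less_mult_iff)
    then show ?thesis using has_sum_Diff[OF ta tb] 2 assms(4) by simp
  next
    case 3
    have "z \<in> I a b \<longleftrightarrow> z \<in> qtail a \<union> qtail b" for z
      using 3 assms(2,3) L_nonzero[of z] 
      by (auto simp: qtail_eq qinterval_def zero_less_mult_iff)
    then have "I a b = qtail a \<union> qtail b" by blast
    moreover have "qtail a \<inter> qtail b = {}"
      using 3 assms by (auto simp: qtail_eq zero_less_mult_iff)
    ultimately show ?thesis using has_sum_Un_disjoint[OF ta tb] 3 by simp
  qed
qed

lemma I_abs_summable:
  assumes "q_antiderivative G g" "a \<in> L" "b \<in> L" "a < b"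
  shows "(\<lambda>z. norm (\<bar>z\<bar> * g z)) summable_on I a b"
  using I_has_sum[OF assms, THEN has_sum_imp_summable] by (rule summable_on_iff_abs_summable_on_real[THEN iffD1])

lemma I_subset: "I a b \<subseteq> L"
  by (auto simp: qinterval_def)

text \<open>The common end b belongs to the left interval if b > 0 and to the right one if b < 0,
  never to both.\<close>

lemma I_ordered:
  assumes "b \<in> L" "u \<in> I a b" "v \<in> I b c" "a < b" "b < c"
  shows "u < v"
  using assms L_nonzero[OF assms(1)] by (auto simp: qinterval_def split: if_splits)

lemma q_tendsto_0: "(\<lambda>n. x * q ^ n) \<longlonglongrightarrow> 0"
  using q by (intro tendsto_mult_right_zero LIMSEQ_power_zero) auto

lemma q_antiderivative_power: "q_antiderivative (\<lambda>x. x ^ Suc k / (1 - q ^ Suc k)) (\<lambda>x. x ^ k)"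
  unfolding q_antiderivative_def
proof (intro ballI conjI)
  fix x assume "x \<in> L"
  have "q ^ Suc k < 1" using q by (intro power_Suc_less_one) auto
  then show "x ^ Suc k / (1 - q ^ Suc k) - (x * q) ^ Suc k / (1 - q ^ Suc k) = x * x ^ k"
    unfolding power_mult_distrib diff_divide_distrib[symmetric] by (simp add: divide_simps) (simp add: algebra_simps)
  have "(\<lambda>n. (x * q ^ n) ^ Suc k / (1 - q ^ Suc k)) \<longlonglongrightarrow> 0 ^ Suc k / (1 - q ^ Suc k)"
    using \<open>q ^ Suc k < 1\<close> by (intro tendsto_intros q_tendsto_0) auto
  then show "(\<lambda>n. (x * q ^ n) ^ Suc k / (1 - q ^ Suc k)) \<longlonglongrightarrow> 0" by simp
  have "(\<lambda>n. (x * q ^ n) ^ k) \<longlonglongrightarrow> 0 ^ k" by (intro tendsto_intros q_tendsto_0)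
  then show "Bseq (\<lambda>n. (x * q ^ n) ^ k)" by (intro convergent_imp_Bseq convergentI)
qed

lemma qspline_eventually_0:
  assumes "y \<noteq> 0"
  shows "eventually (\<lambda>n. qspline q m y (x * q ^ n) = 0) sequentially"
proof -
  have "eventually (\<lambda>n. \<bar>x * q ^ n\<bar> < \<bar>y\<bar>) sequentially"
    using tendstoD[OF q_tendsto_0, of "\<bar>y\<bar>" x] assms by (simp add: dist_real_def)
  then show ?thesis
    by eventually_elim (auto simp: qspline_def)
qed

text \<open>For lattice points x other than y, x and xq lie on the same side of the truncation, and
  \<open>qnodes_Suc_diff\<close> applies. At x = y the value at yq is cut off, but the untruncated
  product vanishes there as well, since yq is its first node.\<close>

lemma q_antiderivative_qspline:
  assumes y: "y \<in> L"
  shows "q_antiderivative (\<lambda>x. qspline q (Suc m) y x / (1 - q ^ Suc m)) (qspline q m y)"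
  unfolding q_antiderivative_def
proof (intro ballI conjI)
  fix x assume x: "x \<in> L"
  have y0: "y \<noteq> 0" using y L_nonzero by auto
  have qm: "q ^ Suc m < 1" using q by (intro power_Suc_less_one) auto
  have node: "qnodes q (Suc m) y (y * q) = 0"
    by (simp add: qnodes_def prod.lessThan_Suc_shift del: prod.lessThan_Suc)
  have "qspline q (Suc m) y x - qspline q (Suc m) y (x * q) = (1 - q ^ Suc m) * x * qspline q m y x"
  proof (cases "x = y")
    case True
    have "y > 0 \<Longrightarrow> y * q < y" "y < 0 \<Longrightarrow> y < y * q" using q by auto
    with True show ?thesis
      using qnodes_Suc_diff[of q m y y] node y0 by (auto simp: qspline_def)
  next
    case False
    have *: "y \<le> x \<longleftrightarrow> y \<le> x * q" if "y > 0"
    proof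
      assume "y \<le> x"
      then show "y \<le> x * q" using L_between[of y x] that x y False by simp
    next
      assume "y \<le> x * q"
      moreover have "x > 0" using that calculation q by (metis less_le_trans zero_less_mult_pos2)
      then have "x * q \<le> x" using q by simp
      ultimately show "y \<le> x" by simp
    qed
    have **: "x \<le> y \<longleftrightarrow> x * q \<le> y" if "y < 0"
    proof
      assume "x \<le> y"
      then show "x * q \<le> y" using L_between[of y x] that x y False by (simp add: zero_less_mult_iff)
    next
      assume "x * q \<le> y"
      moreover have "x < 0" using that calculation q by (metis le_less_trans mult_less_0_iff order_less_imp_not_less)
      then have "x \<le> x * q" using q by simp
      ultimately show "x \<le> y" by simp
    qed
    show ?thesis
      using qnodes_Suc_diff[of q m y x] * ** y0 by (auto simp: qspline_def)
  qed
  then show "qspline q (Suc m) y x / (1 - q ^ Suc m) - qspline q (Suc m) y (x * q) / (1 - q ^ Suc m) = x * qspline q m y x"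
    unfolding diff_divide_distrib[symmetric] using qm by simp
  show "(\<lambda>n. qspline q (Suc m) y (x * q ^ n) / (1 - q ^ Suc m)) \<longlonglongrightarrow> 0"
    using qspline_eventually_0[OF y0, of "Suc m" x]
    by (intro tendsto_eventually) (auto elim!: eventually_mono)
  show "Bseq (\<lambda>n. qspline q m y (x * q ^ n))"
    using qspline_eventually_0[OF y0, of m x]
    by (intro convergent_imp_Bseq convergentI[of _ 0] tendsto_eventually)
qed

text \<open>Without nodes the function is a unit step at y, and its value at y follows the end
  conventions of \<open>qinterval\<close>. This starts the induction on \<open>N\<close>.\<close>

lemma qspline_0_diff:
  assumes "y \<in> L" "a \<in> L" "b \<in> L" "a < b"
  shows "qspline q 0 y b - qspline q 0 y a = of_bool (y \<in> I a b)"
  using assms L_nonzero[of y] L_nonzero[of a] L_nonzero[of b]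
  by (auto simp: qspline_def qnodes_def qinterval_def)

end

section \<open>Interlacing configurations\<close>

text \<open>In decreasing order every factor of the Vandermonde product is positive, which removes
  the absolute values of \<open>link1\<close>.\<close>

definition descending_list :: "real set \<Rightarrow> real list" where
  "descending_list X = rev (sorted_list_of_set X)"

lemma descending_list_basic:
  assumes "finite X"
  shows "length (descending_list X) = card X" "set (descending_list X) = X" "distinct (descending_list X)"
  using assms by (simp_all add: descending_list_def)

lemma descending_list_less:
  assumes "i < j" "j < card X"
  shows "descending_list X ! j < descending_list X ! i"
proof -
  have "card X - Suc j < card X - Suc i" using assms by simp
  then show ?thesis
    using assms strict_sorted_list_of_set[of X]
    by (simp add: descending_list_def rev_nth sorted_wrt_iff_nth_less)
qed

lemma descending_list_eqI:
  assumes "set xs = X" "length xs = n" "\<And>i j. i < j \<Longrightarrow> j < n \<Longrightarrow> xs ! j < xs ! i"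
  shows "descending_list X = xs"
proof -
  have "sorted_wrt (<) (rev xs)"
    unfolding sorted_wrt_rev using assms by (simp add: sorted_wrt_iff_nth_less)
  then have "rev xs = sorted_list_of_set (set (rev xs))"
    by (metis sorted_list_of_set.idem_if_sorted_distinct strict_sorted_iff)
  then show ?thesis using assms(1) by (metis descending_list_def rev_rev_ident set_rev)
qed

text \<open>Both factors change sign in the same way when \<open>ys\<close> is permuted.\<close>

lemma vandermonde_times_det:
  fixes ys :: "real list"
  assumes "distinct ys"
  shows "vandermonde ys * fdet (length ys) (\<lambda>i j. \<phi> i (ys ! j)) =
    fdet (length ys) (\<lambda>i k. \<Sum>y\<in>set ys. \<phi> i y * y ^ (length ys - 1 - k))"
proof -
  have "(\<Sum>j<length ys. \<phi> i (ys ! j) * (ys ! j) ^ e) = (\<Sum>y\<in>set ys. \<phi> i y * y ^ e)" for i e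
    using assms by (intro sum.reindex_bij_betw bij_betw_nth) auto
  then show ?thesis
    by (simp add: vandermonde_det fdet_mult mult.commute[of "fdet _ (\<lambda>i k. ys ! i ^ _ k)"])
qed

text \<open>By \<open>vandermonde_times_det\<close> with powers for \<open>\<phi>\<close>, the
  square of V is a determinant of power sums over the set of points.\<close>

lemma abs_vandermonde_eq:
  fixes xs ys :: "real list"
  assumes "distinct xs" "distinct ys" "set xs = set ys"
  shows "\<bar>vandermonde xs\<bar> = \<bar>vandermonde ys\<bar>"
proof -
  have len: "length xs = length ys" using assms by (metis distinct_card)
  have "vandermonde zs * vandermonde zs =
      fdet (length zs) (\<lambda>i k. \<Sum>z\<in>set zs. z ^ (length zs - 1 - i) * z ^ (length zs - 1 - k))"
    if "distinct zs" for zs :: "real list"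
    using vandermonde_times_det[OF that, of "\<lambda>i y. y ^ (length zs - 1 - i)"]
    by (simp only: vandermonde_det fdet_transpose[of "length zs" "\<lambda>i k. zs ! i ^ (length zs - 1 - k)"])
  then have "(vandermonde xs)\<^sup>2 = (vandermonde ys)\<^sup>2"
    using assms len by (simp add: power2_eq_square)
  then show ?thesis by (simp add: abs_eq_iff power2_eq_iff)
qed

lemma vandermonde_descending_list:
  assumes "finite X"
  shows "vandermonde (descending_list X) > 0" "\<bar>vandermonde (sorted_list_of_set X)\<bar> = vandermonde (descending_list X)"
proof -
  show pos: "vandermonde (descending_list X) > 0"
    unfolding vandermonde_def using descending_list_less[of _ _ X] descending_list_basic[OF assms] by (auto intro!: prod_pos)
  show "\<bar>vandermonde (sorted_list_of_set X)\<bar> = vandermonde (descending_list X)"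
    using abs_vandermonde_eq[of "sorted_list_of_set X" "descending_list X"] pos assms by (simp add: descending_list_basic)
qed

lemma interlaces_descending_list:
  assumes "finite X" "finite Y" "card X = Suc N" "card Y = N"
  shows "interlaces q zp zm N Y X \<longleftrightarrow>
    (\<forall>i<N. descending_list Y ! i \<in> qinterval q zp zm (descending_list X ! Suc i) (descending_list X ! i))"
proof -
  define P where "P = (\<lambda>i. sorted_list_of_set Y ! i \<in>
        qinterval q zp zm (sorted_list_of_set X ! i) (sorted_list_of_set X ! Suc i))"
  have D: "descending_list Y ! i \<in> qinterval q zp zm (descending_list X ! Suc i) (descending_list X ! i) \<longleftrightarrow> P (N - Suc i)" if "i < N" for i
    using that assms by (simp add: P_def descending_list_def rev_nth Suc_diff_Suc)
  have "(\<forall>i<N. P i) \<longleftrightarrow> (\<forall>i<N. P (N - Suc i))"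
  proof (intro iffI allI impI)
    fix i assume "\<forall>i<N. P (N - Suc i)" "i < N"
    then have "P (N - Suc (N - Suc i))" by (metis diff_less_Suc diff_Suc_less less_zeroE not_less_eq zero_less_iff_neq_zero)
    then show "P i" using \<open>i < N\<close> by (simp add: Suc_diff_Suc)
  qed auto
  moreover have "interlaces q zp zm N Y X \<longleftrightarrow> (\<forall>i<N. P i)"
    by (simp add: interlaces_def P_def)
  ultimately show ?thesis using D by simp
qed

text \<open>The permuted list is again a decreasing enumeration of the same set, and there is only
  one.\<close>

lemma permutes_order_preserving:
  fixes ys :: "real list"
  assumes p: "p permutes {..<n}" and len: "length ys = n"
    and dec: "\<And>i j. i < j \<Longrightarrow> j < n \<Longrightarrow> ys ! j < ys ! i"
    and dec': "\<And>i j. i < j \<Longrightarrow> j < n \<Longrightarrow> ys ! p j < ys ! p i"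
    and i: "i < n"
  shows "ys ! p i = ys ! i"
proof -
  define zs where "zs = map (\<lambda>i. ys ! p i) [0..<n]"
  have "set zs = (\<lambda>i. ys ! i) ` p ` {..<n}"
    by (auto simp: zs_def image_image)
  also have "\<dots> = set ys"
    using permutes_image[OF p] len by (auto simp: set_conv_nth)
  finally have "descending_list (set ys) = zs"
    by (intro descending_list_eqI[where n = n]) (auto simp: zs_def dec')
  moreover have "descending_list (set ys) = ys"
    by (rule descending_list_eqI[OF refl len dec])
  ultimately have "zs = ys" by simp
  then have "zs ! i = ys ! i" by simp
  then show ?thesis using i by (simp add: zs_def)
qed

lemma has_sum_finite_sum:
  fixes f :: "'i \<Rightarrow> 'a \<Rightarrow> 'b::topological_comm_monoid_add"
  assumes "finite P" "\<And>p. p \<in> P \<Longrightarrow> (f p has_sum s p) A"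
  shows "((\<lambda>x. \<Sum>p\<in>P. f p x) has_sum (\<Sum>p\<in>P. s p)) A"
  using assms by (induction P rule: finite_induct) (auto intro!: has_sum_add simp: has_sum_0)

text \<open>Each Leibniz term is a product over rows, so its absolutely convergent sum over the
  product set factors. Reassembling the terms sums every row separately.\<close>

lemma infsum_PiE_det:
  fixes F :: "nat \<Rightarrow> real \<Rightarrow> real" and J :: "nat \<Rightarrow> real set"
  assumes sm: "\<And>i c. i < N \<Longrightarrow> c < N \<Longrightarrow> (\<lambda>z. norm (\<bar>z\<bar> * F c z)) summable_on J i"
    and S: "\<And>i c. i < N \<Longrightarrow> c < N \<Longrightarrow> infsum (\<lambda>z. \<bar>z\<bar> * F c z) (J i) = S i c"
    and cnt: "\<And>i. i < N \<Longrightarrow> countable (J i)"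
  shows "infsum (\<lambda>z. (\<Prod>i<N. \<bar>z i\<bar>) * fdet N (\<lambda>i c. F c (z i))) (PiE {..<N} J) = fdet N S"
proof -
  have pN: "p i < N" if "p permutes {..<N}" "i < N" for p i
    using permutes_in_image[OF that(1), of i] that(2) by simp
  have "((\<lambda>z. signof p * (\<Prod>i<N. \<bar>z i\<bar> * F (p i) (z i))) has_sum signof p * (\<Prod>i<N. S i (p i))) (PiE {..<N} J)"
    if p: "p permutes {..<N}" for p
  proof -
    have "Infinite_Set_Sum.abs_summable_on (\<lambda>z. \<Prod>i<N. \<bar>z i\<bar> * F (p i) (z i)) (PiE {..<N} J)"
      using cnt sm pN[OF p] by (intro abs_summable_on_prod_PiE) (auto simp: abs_summable_equivalent[symmetric])
    then have "(\<lambda>z. \<Prod>i<N. \<bar>z i\<bar> * F (p i) (z i)) summable_on (PiE {..<N} J)"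
      unfolding abs_summable_equivalent[symmetric] by (rule abs_summable_summable)
    moreover have "infsum (\<lambda>z. \<Prod>i<N. \<bar>z i\<bar> * F (p i) (z i)) (PiE {..<N} J) = (\<Prod>i<N. infsum (\<lambda>z. \<bar>z\<bar> * F (p i) z) (J i))"
      using sm pN[OF p] by (intro infsum_prod_PiE_abs) auto
    moreover have "\<dots> = (\<Prod>i<N. S i (p i))"
      using pN[OF p] by (intro prod.cong) (auto simp: S)
    ultimately show ?thesis
      by (intro has_sum_cmult_right) (simp add: has_sum_iff)
  qed
  then have "((\<lambda>z. \<Sum>p | p permutes {..<N}. signof p * (\<Prod>i<N. \<bar>z i\<bar> * F (p i) (z i))) has_sum fdet N S) (PiE {..<N} J)"
    unfolding fdet_Leibniz by (intro has_sum_finite_sum) (auto simp: finite_permutations)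
  moreover have "(\<Prod>i<N. \<bar>z i\<bar>) * fdet N (\<lambda>i c. F c (z i)) =
      (\<Sum>p | p permutes {..<N}. signof p * (\<Prod>i<N. \<bar>z i\<bar> * F (p i) (z i)))" for z
    unfolding fdet_Leibniz sum_distrib_left by (simp add: prod.distrib mult_ac)
  ultimately show ?thesis by (simp add: infsumI)
qed

section \<open>Summation over interlacing configurations\<close>

context qlattice_params
begin

lemma countable_L: "countable L"
proof -
  have "L = range (\<lambda>n::int. zp * q powi n) \<union> range (\<lambda>n::int. zm * q powi n)"
    by (auto simp: qlattice_def)
  then show ?thesis by simp
qed

abbreviation J where "J X i \<equiv> I (descending_list X ! Suc i) (descending_list X ! i)"

lemma configsD:
  assumes "X \<in> configs q zp zm N"
  shows "finite X" "card X = N" "X \<subseteq> L" "length (descending_list X) = N" "i < N \<Longrightarrow> descending_list X ! i \<in> L"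
  using assms descending_list_basic[of X] nth_mem[of i "descending_list X"] by (auto simp: configs_def)

lemma J_ordered:
  assumes X: "X \<in> configs q zp zm (Suc N)" and ij: "i < j" "j < N"
    and u: "u \<in> J X i" and v: "v \<in> J X j"
  shows "v < u"
proof -
  have X': "descending_list X ! Suc i \<in> L" "descending_list X ! Suc i < descending_list X ! i" "descending_list X ! Suc j < descending_list X ! j"
    using configsD[OF X] descending_list_less[of i "Suc i" X] descending_list_less[of j "Suc j" X] ij by auto
  show ?thesis
  proof (cases "j = Suc i")
    case True
    then show ?thesis
      using I_ordered[of "descending_list X ! Suc i" v "descending_list X ! Suc j" u "descending_list X ! i"] X' u v by simp
  next
    case False
    then have "descending_list X ! j < descending_list X ! Suc i"
      using descending_list_less[of "Suc i" j X] configsD[OF X] ij by simp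
    moreover have "v \<le> descending_list X ! j" "descending_list X ! Suc i \<le> u"
      using u v by (auto simp: qinterval_def split: if_splits)
    ultimately show ?thesis by simp
  qed
qed

text \<open>The intervals are disjoint and ordered, so choosing one point from each always yields a
  decreasing list of distinct points. Summation over interlacing sets thereby becomes summation over
  a product.\<close>

lemma interlacing_bij:
  assumes X: "X \<in> configs q zp zm (Suc N)"
  shows "bij_betw (\<lambda>g. g ` {..<N}) (PiE {..<N} (J X)) {Z \<in> configs q zp zm N. interlaces q zp zm N Z X}"
    and "g \<in> PiE {..<N} (J X) \<Longrightarrow> descending_list (g ` {..<N}) = map g [0..<N]"
    and "g \<in> PiE {..<N} (J X) \<Longrightarrow> inj_on g {..<N}"
proof -
  have inj: "inj_on g {..<N}" if "g \<in> PiE {..<N} (J X)" for g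
  proof (rule linorder_inj_onI')
    fix i j assume ij: "i \<in> {..<N}" "j \<in> {..<N}" "i < j"
    then have "g i \<in> J X i" "g j \<in> J X j"
      using PiE_mem[OF that, of i] PiE_mem[OF that, of j] by simp_all
    then have "g j < g i" using J_ordered[OF X] ij by blast
    then show "g i \<noteq> g j" by simp
  qed
  then show "g \<in> PiE {..<N} (J X) \<Longrightarrow> inj_on g {..<N}" .
  have dl: "descending_list (g ` {..<N}) = map g [0..<N]" if "g \<in> PiE {..<N} (J X)" for g
  proof (rule descending_list_eqI)
    fix i j assume ij: "i < j" "j < N"
    then have "g i \<in> J X i" "g j \<in> J X j"
      using PiE_mem[OF that, of i] PiE_mem[OF that, of j] by simp_all
    then show "map g [0..<N] ! j < map g [0..<N] ! i" using J_ordered[OF X] ij by simp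
  qed (auto simp: atLeast0LessThan)
  then show "g \<in> PiE {..<N} (J X) \<Longrightarrow> descending_list (g ` {..<N}) = map g [0..<N]" .
  show "bij_betw (\<lambda>g. g ` {..<N}) (PiE {..<N} (J X)) {Z \<in> configs q zp zm N. interlaces q zp zm N Z X}"
  proof (rule bij_betw_imageI)
    show "inj_on (\<lambda>g. g ` {..<N}) (PiE {..<N} (J X))"
    proof (rule inj_onI)
      fix g h assume gh: "g \<in> PiE {..<N} (J X)" "h \<in> PiE {..<N} (J X)" and "g ` {..<N} = h ` {..<N}"
      then have "map g [0..<N] = map h [0..<N]" using dl by metis
      then show "g = h" using gh by (intro PiE_ext) auto
    qed
    show "(\<lambda>g. g ` {..<N}) ` PiE {..<N} (J X) = {Z \<in> configs q zp zm N. interlaces q zp zm N Z X}"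
    proof (intro equalityI subsetI)
      fix Z assume "Z \<in> (\<lambda>g. g ` {..<N}) ` PiE {..<N} (J X)"
      then obtain g where g: "g \<in> PiE {..<N} (J X)" "Z = g ` {..<N}" by auto
      have "inj_on g {..<N}" using g by (intro inj)
      then have card: "card Z = N" using g by (simp add: card_image)
      have "Z \<subseteq> L" using g I_subset by fastforce
      then have "Z \<in> configs q zp zm N" using card g by (simp add: configs_def)
      moreover have "interlaces q zp zm N Z X"
        using configsD[OF X] card g dl[OF g(1)] by (subst interlaces_descending_list) auto
      ultimately show "Z \<in> {Z \<in> configs q zp zm N. interlaces q zp zm N Z X}" by simp
    next
      fix Z assume Z: "Z \<in> {Z \<in> configs q zp zm N. interlaces q zp zm N Z X}"
      define g where "g = restrict (\<lambda>i. descending_list Z ! i) {..<N}"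
      have Zc: "finite Z" "card Z = N" "length (descending_list Z) = N" using Z configsD by auto
      have "g \<in> PiE {..<N} (J X)"
        using Z Zc configsD[OF X] by (auto simp: g_def interlaces_descending_list)
      moreover have "g ` {..<N} = set (descending_list Z)"
        using Zc by (auto simp: g_def set_conv_nth)
      then have "g ` {..<N} = Z" using Zc descending_list_basic by simp
      ultimately show "Z \<in> (\<lambda>g. g ` {..<N}) ` PiE {..<N} (J X)" by blast
    qed
  qed
qed

text \<open>One step of the kernel acting on a determinant: \<open>interlacing_bij\<close> gives a
  product set, \<open>infsum_PiE_det\<close> sums row by row, and \<open>I_has_sum\<close> evaluates
  each entry.\<close>

lemma interlacing_sum_det:
  assumes X: "X \<in> configs q zp zm (Suc N)" and G: "\<And>c. c < N \<Longrightarrow> q_antiderivative (G c) (F c)"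
  shows "infsum (\<lambda>Z. (\<Prod>z\<in>Z. \<bar>z\<bar>) * fdet N (\<lambda>i c. F c (descending_list Z ! i)))
      {Z \<in> configs q zp zm N. interlaces q zp zm N Z X} =
    fdet N (\<lambda>i c. G c (descending_list X ! i) - G c (descending_list X ! Suc i))"
proof -
  have "infsum (\<lambda>Z. (\<Prod>z\<in>Z. \<bar>z\<bar>) * fdet N (\<lambda>i c. F c (descending_list Z ! i)))
      {Z \<in> configs q zp zm N. interlaces q zp zm N Z X} =
    infsum (\<lambda>g. (\<Prod>z\<in>g ` {..<N}. \<bar>z\<bar>) * fdet N (\<lambda>i c. F c (descending_list (g ` {..<N}) ! i))) (PiE {..<N} (J X))"
    using infsum_reindex_bij_betw[OF interlacing_bij(1)[OF X]] by (rule sym)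
  also have "\<dots> = infsum (\<lambda>g. (\<Prod>i<N. \<bar>g i\<bar>) * fdet N (\<lambda>i c. F c (g i))) (PiE {..<N} (J X))"
  proof (rule infsum_cong)
    fix g assume g: "g \<in> PiE {..<N} (J X)"
    then have "inj_on g {..<N}" by (rule interlacing_bij(3)[OF X])
    then have "(\<Prod>z\<in>g ` {..<N}. \<bar>z\<bar>) = (\<Prod>i<N. \<bar>g i\<bar>)" by (simp add: prod.reindex)
    moreover have "fdet N (\<lambda>i c. F c (descending_list (g ` {..<N}) ! i)) = fdet N (\<lambda>i c. F c (g i))"
      unfolding interlacing_bij(2)[OF X g] by (rule fdet_cong) simp
    ultimately show "(\<Prod>z\<in>g ` {..<N}. \<bar>z\<bar>) * fdet N (\<lambda>i c. F c (descending_list (g ` {..<N}) ! i)) =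
        (\<Prod>i<N. \<bar>g i\<bar>) * fdet N (\<lambda>i c. F c (g i))" by simp
  qed
  also have "\<dots> = fdet N (\<lambda>i c. G c (descending_list X ! i) - G c (descending_list X ! Suc i))"
  proof (rule infsum_PiE_det)
    fix i c assume "i < N" "c < N"
    then have *: "q_antiderivative (G c) (F c)" "descending_list X ! Suc i \<in> L" "descending_list X ! i \<in> L" "descending_list X ! Suc i < descending_list X ! i"
      using G configsD[OF X] descending_list_less[of i "Suc i" X] by auto
    show "(\<lambda>z. norm (\<bar>z\<bar> * F c z)) summable_on J X i" by (rule I_abs_summable[OF *])
    show "infsum (\<lambda>z. \<bar>z\<bar> * F c z) (J X i) = G c (descending_list X ! i) - G c (descending_list X ! Suc i)"
      by (rule infsumI[OF I_has_sum[OF *]])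
  qed (use countable_L I_subset countable_subset in blast)
  finally show ?thesis .
qed

text \<open>By symmetry \<open>Y\<close> may be listed in decreasing order. If it interlaces, the
  ordering of the intervals makes the matrix lower triangular with unit diagonal. Otherwise a
  nonzero Leibniz term would place the permuted points in the successive intervals; they would then
  be decreasing, so the permutation would change nothing and \<open>Y\<close> would
  interlace.\<close>

lemma interlacing_indicator_det:
  assumes X: "X \<in> configs q zp zm (Suc K)" and Y: "Y \<in> configs q zp zm K"
    and ys: "distinct ys" "set ys = Y"
  shows "vandermonde ys * fdet K (\<lambda>i j. of_bool (ys ! j \<in> J X i)) =
    vandermonde (descending_list Y) * of_bool (interlaces q zp zm K Y X)"
proof -
  define y where "y = (\<lambda>i. descending_list Y ! i)"
  have len: "length ys = K" "length (descending_list Y) = K" "finite Y" "card Y = K"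
    using ys configsD[OF Y] distinct_card[of ys] by auto
  have il: "interlaces q zp zm K Y X \<longleftrightarrow> (\<forall>i<K. y i \<in> J X i)"
    unfolding y_def using configsD[OF X] len by (intro interlaces_descending_list) auto
  have yless: "y j < y i" if "i < j" "j < K" for i j
    using descending_list_less that len by (simp add: y_def)
  have "fdet K (\<lambda>i j. of_bool (y j \<in> J X i)) = (of_bool (\<forall>i<K. y i \<in> J X i) :: real)"
  proof (cases "\<forall>i<K. y i \<in> J X i")
    case True
    have "y j \<notin> J X i" if "i < j" "j < K" for i j
      using J_ordered[OF X that, of "y j" "y j"] that True by auto
    then have "fdet K (\<lambda>i j. of_bool (y j \<in> J X i)) = (\<Prod>i<K. of_bool (y i \<in> J X i) :: real)"
      by (intro fdet_lower_triangular) auto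
    then show ?thesis using True by simp
  next
    case False
    have "(\<Prod>i<K. of_bool (y (p i) \<in> J X i) :: real) = 0" if p: "p permutes {..<K}" for p
    proof (rule ccontr)
      assume "(\<Prod>i<K. of_bool (y (p i) \<in> J X i) :: real) \<noteq> 0"
      then have *: "y (p i) \<in> J X i" if "i < K" for i using that by (auto simp: prod_zero_iff)
      have "y (p i) = y i" if "i < K" for i
        unfolding y_def
        by (rule permutes_order_preserving[OF p len(2)])
           (use J_ordered[OF X] * yless that in \<open>auto simp: y_def\<close>)
      then show False using * False by metis
    qed
    then have "fdet K (\<lambda>i j. of_bool (y j \<in> J X i)) = (0 :: real)"
      unfolding fdet_Leibniz by (intro sum.neutral ballI) (simp del: prod_zero_iff)
    then show ?thesis using False by simp
  qed
  moreover have "vandermonde ys * fdet K (\<lambda>i j. of_bool (ys ! j \<in> J X i)) =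
      vandermonde (descending_list Y) * fdet K (\<lambda>i j. of_bool (y j \<in> J X i))"
    using vandermonde_times_det[of ys "\<lambda>i y. of_bool (y \<in> J X i)"]
      vandermonde_times_det[of "descending_list Y" "\<lambda>i y. of_bool (y \<in> J X i)"] len ys
    by (simp add: descending_list_basic y_def)
  ultimately show ?thesis using il by simp
qed

end

section \<open>The iterated kernel\<close>

definition link_coeff :: "real \<Rightarrow> nat \<Rightarrow> nat \<Rightarrow> real" where
  "link_coeff q K N = (\<Prod>i=1..K. qpoch q q (N - i) / (qpoch q q (K - i) * qpoch q q (N - K))) * (1 - q ^ (N - K)) ^ K"

lemma qpoch_Suc: "qpoch q q (Suc n) = qpoch q q n * (1 - q ^ Suc n)"
  by (simp add: qpoch_def)

context qlattice_params
begin

lemma qpoch_nonzero: "qpoch q q n \<noteq> 0"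
proof -
  have "q * q ^ i < 1" for i using q power_Suc_less_one[of q i] by simp
  then show ?thesis unfolding qpoch_def by (auto simp: less_irrefl dest: sym) (metis less_irrefl)
qed

lemma one_minus_qpower_nonzero: "n > 0 \<Longrightarrow> 1 - q ^ n \<noteq> 0"
  using q power_Suc_less_one[of q "n - 1"] by (cases n) auto

text \<open>Each quotient of Pochhammer symbols is a single factor over (q;q)_1 = 1 - q, and the
  \<open>K\<close> denominators cancel the power of 1 - q.\<close>

lemma link_coeff_Suc_self: "link_coeff q K (Suc K) = qpoch q q K"
proof -
  have "(\<Prod>i=1..K. qpoch q q (Suc K - i) / (qpoch q q (K - i) * qpoch q q (Suc K - K))) =
     (\<Prod>i=1..K. (1 - q ^ (Suc K - i)) / (1 - q))"
  proof (intro prod.cong refl)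
    fix i assume "i \<in> {1..K}"
    then have "Suc K - i = Suc (K - i)" by auto
    then show "qpoch q q (Suc K - i) / (qpoch q q (K - i) * qpoch q q (Suc K - K)) = (1 - q ^ (Suc K - i)) / (1 - q)"
      using qpoch_nonzero[of "K - i"] by (simp only: qpoch_Suc) (simp add: qpoch_def)
  qed
  also have "\<dots> = (\<Prod>i=1..K. 1 - q ^ (Suc K - i)) / (1 - q) ^ K"
    by (simp add: prod_dividef)
  also have "(\<Prod>i=1..K. 1 - q ^ (Suc K - i)) = qpoch q q K"
    unfolding qpoch_def
    by (rule prod.reindex_bij_witness[of _ "\<lambda>i. K - i" "\<lambda>i. K - i"]) (auto simp: Suc_diff_le)
  finally show ?thesis
    using q by (simp add: link_coeff_def)
qed

text \<open>Both sides multiply (q;q)_n over n from \<open>N - K\<close> to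
  \<open>N\<close>.\<close>

lemma prod_qpoch_shift:
  assumes "K \<le> N"
  shows "(\<Prod>i=1..K. qpoch q q (Suc N - i)) * qpoch q q (N - K) = qpoch q q N * (\<Prod>i=1..K. qpoch q q (N - i))"
  using assms
proof (induction K)
  case (Suc K)
  have "(\<Prod>i=1..Suc K. qpoch q q (Suc N - i)) * qpoch q q (N - Suc K)
     = ((\<Prod>i=1..K. qpoch q q (Suc N - i)) * qpoch q q (N - K)) * qpoch q q (N - Suc K)"
    by simp
  also have "\<dots> = qpoch q q N * (\<Prod>i=1..Suc K. qpoch q q (N - i))"
    using Suc by simp
  finally show ?case .
qed simp

text \<open>The recursion required by the induction on \<open>N\<close>: (q;q)_N comes from
  \<open>link1\<close>, and the factor on the left collects the constants of the column
  antiderivatives.\<close>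

lemma link_coeff_Suc:
  assumes "K < N"
  shows "link_coeff q K (Suc N) * ((1 - q ^ (N - K)) ^ K * qpoch q q (N - K)) = link_coeff q K N * qpoch q q N"
proof -
  define P where "P = (\<Prod>i=1..K. qpoch q q (K - i))"
  define A where "A = (\<lambda>N. \<Prod>i=1..K. qpoch q q (N - i))"
  define n where "n = N - K"
  have n: "Suc N - K = Suc n" "N - K = n" using assms by (auto simp: n_def)
  have cf: "link_coeff q K M = A M / (P * qpoch q q (M - K) ^ K) * (1 - q ^ (M - K)) ^ K" for M
    by (simp add: link_coeff_def A_def P_def prod_dividef prod.distrib)
  have nz: "P \<noteq> 0" "qpoch q q n \<noteq> 0" "1 - q ^ Suc n \<noteq> 0"
    using qpoch_nonzero one_minus_qpower_nonzero[of "Suc n"] by (auto simp: P_def)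
  have "link_coeff q K (Suc N) = A (Suc N) / (P * qpoch q q n ^ K)"
    using nz unfolding cf n qpoch_Suc power_mult_distrib by simp
  moreover have "A (Suc N) * qpoch q q n = qpoch q q N * A N"
    using prod_qpoch_shift[of K N] assms by (simp add: A_def n_def)
  ultimately show ?thesis
    using nz unfolding cf n by (simp add: mult_ac)
qed

text \<open>The columns of the determinant in the overview. For K < N the last one is constantly 1,
  as \<open>fdet_Suc_ones\<close> demands.\<close>

definition entry :: "nat \<Rightarrow> real list \<Rightarrow> nat \<Rightarrow> nat \<Rightarrow> real \<Rightarrow> real" where
  "entry K ys N c x = (if c < K then qspline q (N - K - 1) (ys ! c) x else x ^ (N - 1 - c))"

lemma link_det:
  assumes Y: "Y \<in> configs q zp zm K" and ys: "distinct ys" "set ys = Y"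
    and "K < N" and X: "X \<in> configs q zp zm N"
  shows "link q zp zm K N X Y = link_coeff q K N * vandermonde ys * (\<Prod>y\<in>Y. \<bar>y\<bar>) *
    fdet N (\<lambda>i c. entry K ys N c (descending_list X ! i)) / vandermonde (descending_list X)"
proof -
  have Suc_le: "Suc K \<le> N" using assms by simp
  have len: "length ys = K" using ys configsD[OF Y] distinct_card[of ys] by simp
  have ysL: "ys ! c \<in> L" if "c < K" for c
    using that len ys configsD[OF Y] nth_mem[of c ys] by auto
  show ?thesis
    using Suc_le X
  proof (induction N arbitrary: X rule: dec_induct)
    case base
    note X = base
    have "fdet (Suc K) (\<lambda>i c. entry K ys (Suc K) c (descending_list X ! i)) =
        fdet K (\<lambda>i c. entry K ys (Suc K) c (descending_list X ! i) - entry K ys (Suc K) c (descending_list X ! Suc i))"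
      by (rule fdet_Suc_ones) (simp add: entry_def)
    \<comment> \<open>At size \<open>K + 1\<close> the splines have no nodes, so differences over
      intervals are membership indicators.\<close>
    also have "\<dots> = fdet K (\<lambda>i c. of_bool (ys ! c \<in> J X i))"
      using configsD[OF X] descending_list_less[of _ "Suc _" X] ysL
      by (intro fdet_cong) (simp add: entry_def qspline_0_diff)
    finally have det: "vandermonde ys * fdet (Suc K) (\<lambda>i c. entry K ys (Suc K) c (descending_list X ! i)) =
        vandermonde (descending_list Y) * of_bool (interlaces q zp zm K Y X)"
      using interlacing_indicator_det[OF X Y ys] by simp
    have "link q zp zm K (Suc K) X Y = qpoch q q K * (\<Prod>y\<in>Y. \<bar>y\<bar>) *
        (vandermonde (descending_list Y) * of_bool (interlaces q zp zm K Y X)) / vandermonde (descending_list X)"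
      using configsD[OF X] configsD[OF Y] by (simp add: link1_def vandermonde_descending_list)
    then show ?case
      unfolding det[symmetric] by (simp add: link_coeff_Suc_self mult_ac)
  next
    case (step N)
    note X = step.prems
    define d where "d = (\<lambda>Z. fdet N (\<lambda>i c. entry K ys N c (descending_list Z ! i)))"
    \<comment> \<open>The constant by which the antiderivative of column c has to be multiplied to
      give column c at size \<open>N + 1\<close>.\<close>
    define \<kappa> where "\<kappa> = (\<lambda>c. if c < K then 1 - q ^ (N - K) else 1 - q ^ (N - c))"
    define G where "G = (\<lambda>c x. entry K ys (Suc N) c x / \<kappa> c)"
    define C where "C = link_coeff q K N * vandermonde ys * (\<Prod>y\<in>Y. \<bar>y\<bar>)"
    have KN: "K < N" using step.hyps by simp
    have \<kappa>: "\<kappa> c \<noteq> 0" if "c < N" for c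
      using one_minus_qpower_nonzero KN that by (simp add: \<kappa>_def)
    have anti: "q_antiderivative (G c) (entry K ys N c)" if "c < N" for c
    proof (cases "c < K")
      case True
      have "Suc N - K - 1 = Suc (N - K - 1)" "N - K = Suc (N - K - 1)" using KN by auto
      with True have "entry K ys N c = qspline q (N - K - 1) (ys ! c)"
        "G c = (\<lambda>x. qspline q (Suc (N - K - 1)) (ys ! c) x / (1 - q ^ Suc (N - K - 1)))"
        by (simp_all add: fun_eq_iff G_def entry_def \<kappa>_def)
      then show ?thesis
        using q_antiderivative_qspline[OF ysL[OF True]] by simp
    next
      case False
      have "Suc N - 1 - c = Suc (N - 1 - c)" "N - c = Suc (N - 1 - c)" using that by auto
      with False have "entry K ys N c = (\<lambda>x. x ^ (N - 1 - c))"
        "G c = (\<lambda>x. x ^ Suc (N - 1 - c) / (1 - q ^ Suc (N - 1 - c)))"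
        by (simp_all add: fun_eq_iff G_def entry_def \<kappa>_def)
      then show ?thesis
        using q_antiderivative_power by simp
    qed
    \<comment> \<open>The \<open>K\<close> spline columns contribute equal factors; the power
      columns run through 1 - q^n for n from 1 to \<open>N - K\<close>.\<close>
    have "(\<Prod>c<N. \<kappa> c) = (\<Prod>c<K. \<kappa> c) * (\<Prod>c=K..<N. \<kappa> c)"
      using prod.atLeastLessThan_concat[of 0 K N \<kappa>] KN by (simp add: lessThan_atLeast0)
    also have "(\<Prod>c=K..<N. \<kappa> c) = qpoch q q (N - K)"
      unfolding qpoch_def
      by (rule prod.reindex_bij_witness[of _ "\<lambda>i. N - Suc i" "\<lambda>i. N - Suc i"])
         (auto simp: \<kappa>_def power_Suc[symmetric] Suc_diff_Suc simp del: power_Suc)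
    finally have prod_\<kappa>: "(\<Prod>c<N. \<kappa> c) = (1 - q ^ (N - K)) ^ K * qpoch q q (N - K)"
      by (simp add: \<kappa>_def)
    have "fdet (Suc N) (\<lambda>i c. entry K ys (Suc N) c (descending_list X ! i)) =
        fdet N (\<lambda>i c. entry K ys (Suc N) c (descending_list X ! i) - entry K ys (Suc N) c (descending_list X ! Suc i))"
      using KN by (intro fdet_Suc_ones) (simp add: entry_def)
    also have "\<dots> = fdet N (\<lambda>i c. \<kappa> c * (G c (descending_list X ! i) - G c (descending_list X ! Suc i)))"
      using \<kappa> by (intro fdet_cong) (simp add: G_def right_diff_distrib)
    also have "\<dots> = (\<Prod>c<N. \<kappa> c) * fdet N (\<lambda>i c. G c (descending_list X ! i) - G c (descending_list X ! Suc i))"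
      by (rule fdet_scale_cols)
    finally have det: "fdet (Suc N) (\<lambda>i c. entry K ys (Suc N) c (descending_list X ! i)) =
      (\<Prod>c<N. \<kappa> c) * fdet N (\<lambda>i c. G c (descending_list X ! i) - G c (descending_list X ! Suc i))" .
    have "link q zp zm K (Suc N) X Y = (\<Sum>\<^sub>\<infinity>Z\<in>configs q zp zm N. link1 q zp zm N X Z * link q zp zm K N Z Y)"
      using KN by simp
    \<comment> \<open>V(Z) in the numerator of \<open>link1\<close> cancels the denominator from the
      induction hypothesis, and non-interlacing \<open>Z\<close> contribute 0.\<close>
    also have "\<dots> = (\<Sum>\<^sub>\<infinity>Z\<in>{Z \<in> configs q zp zm N. interlaces q zp zm N Z X}.
        qpoch q q N * C / vandermonde (descending_list X) * ((\<Prod>z\<in>Z. \<bar>z\<bar>) * d Z))"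
    proof (rule infsum_cong_neutral)
      fix Z assume Z: "Z \<in> configs q zp zm N \<inter> {Z \<in> configs q zp zm N. interlaces q zp zm N Z X}"
      then have Zc: "Z \<in> configs q zp zm N" by simp
      have "vandermonde (descending_list Z) \<noteq> 0"
        using vandermonde_descending_list(1)[of Z] configsD[OF Zc] by simp
      then show "link1 q zp zm N X Z * link q zp zm K N Z Y =
          qpoch q q N * C / vandermonde (descending_list X) * ((\<Prod>z\<in>Z. \<bar>z\<bar>) * d Z)"
        using Z configsD[OF Zc] configsD[OF X]
        by (simp add: step.IH[OF Zc] link1_def vandermonde_descending_list C_def d_def)
    qed (auto simp: link1_def)
    also have "\<dots> = qpoch q q N * C / vandermonde (descending_list X) *
        fdet N (\<lambda>i c. G c (descending_list X ! i) - G c (descending_list X ! Suc i))"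
      unfolding d_def infsum_cmult_right'
      by (subst interlacing_sum_det[OF X, of G]) (use anti in auto)
    also have "qpoch q q N * C = link_coeff q K (Suc N) * vandermonde ys * (\<Prod>y\<in>Y. \<bar>y\<bar>) * (\<Prod>c<N. \<kappa> c)"
      using link_coeff_Suc[OF KN] by (simp add: C_def prod_\<kappa> mult_ac)
    finally show ?case
      by (simp only: det) (simp add: mult_ac)
  qed
qed

text \<open>By \<open>L_between\<close> no lattice point lies strictly between y and yq, so lying
  beyond c, away from 0, means lying at or beyond y. \<open>min\<close> and \<open>max\<close> treat
  both signs, since y < yq for negative y.\<close>

lemma contour_separates:
  assumes "y \<in> L" and c: "min y (y * q) < c" "c < max y (y * q)"
  shows "y > 0 \<and> c > 0 \<and> (\<forall>x\<in>L. c < x \<longleftrightarrow> y \<le> x) \<or> y < 0 \<and> c < 0 \<and> (\<forall>x\<in>L. x < c \<longleftrightarrow> x \<le> y)"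
    and "c \<notin> L"
proof -
  have y0: "y \<noteq> 0" using assms L_nonzero by auto
  have *: "y > 0 \<and> c > 0 \<and> (\<forall>x\<in>L. c < x \<longleftrightarrow> y \<le> x) \<and> c \<notin> L" if "y > 0"
  proof -
    have yq: "0 < y * q" "y * q < c" "c < y" using that q c by (auto simp: min_def max_def split: if_splits)
    have gap: "y \<le> x" if "x \<in> L" "c \<le> x" for x
      using L_between[of x y] that yq assms by (cases "y \<le> x") (auto simp: zero_less_mult_iff)
    show ?thesis using that yq gap by (auto dest: less_imp_le) (use gap yq in force)
  qed
  have **: "y < 0 \<and> c < 0 \<and> (\<forall>x\<in>L. x < c \<longleftrightarrow> x \<le> y) \<and> c \<notin> L" if "y < 0"
  proof -
    have "y < y * q" using that q by simp
    then have yq: "y * q < 0" "c < y * q" "y < c" using that q c by (auto simp: mult_neg_pos min_def max_def split: if_splits)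
    have gap: "x \<le> y" if "x \<in> L" "x \<le> c" for x
      using L_between[of x y] that yq assms by (cases "x \<le> y") (auto simp: zero_less_mult_iff)
    show ?thesis using that yq gap by (auto dest: less_imp_le) (use gap yq in force)
  qed
  show "y > 0 \<and> c > 0 \<and> (\<forall>x\<in>L. c < x \<longleftrightarrow> y \<le> x) \<or> y < 0 \<and> c < 0 \<and> (\<forall>x\<in>L. x < c \<longleftrightarrow> x \<le> y)"
    and "c \<notin> L"
    using * ** y0 by (metis linorder_neqE)+
qed

end

theorem theorem3p6:
  fixes q zp zm :: real and N K :: nat and X Y :: "real set" and ys cs :: "real list"
  assumes "0 < q" "q < 1" "zp > 0" "zm < 0"
    and "1 \<le> K" "K < N"
    and "X \<in> configs q zp zm N"
    and "Y \<in> configs q zp zm K"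
    and "distinct ys" "set ys = Y"
    and "length cs = K"
    and "\<And>j. j < K \<Longrightarrow> min (ys ! j) (ys ! j * q) < cs ! j \<and> cs ! j < max (ys ! j) (ys ! j * q)"
  shows "complex_of_real (link q zp zm K N X Y) =
    complex_of_real (vandermonde ys *
      (\<Prod>i=1..K. qpoch q q (N - i) / (qpoch q q (K - i) * qpoch q q (N - K)))) *
    (complex_of_real ((1 - q ^ (N - K)) ^ K * (\<Prod>j<K. \<bar>ys ! j\<bar>)) / (2 * complex_of_real pi * \<i>) ^ K) *
    iterated_vline_integral cs (\<lambda>zs.
      vandermonde (map inverse zs) *
      (\<Prod>j<K.
        qpoch (complex_of_real (ys ! j) * inverse (zs ! j) * complex_of_real q) (complex_of_real q) (N - K - 1) /
        (\<Prod>x\<in>X. 1 - complex_of_real x * inverse (zs ! j)) *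
        (1 / (zs ! j)\<^sup>2)))"
proof -
  interpret qlattice_params q zp zm using assms by unfold_locales
  have X: "X \<in> configs q zp zm N" and Y: "Y \<in> configs q zp zm K" by fact+
  note Xc = configsD[OF X] and Yc = configsD[OF Y]
  have len: "length ys = K"
    using assms(9,10) Yc distinct_card[of ys] by simp
  have ysL: "ys ! j \<in> L" if "j < K" for j
    using that len assms(10) Yc nth_mem[of j ys] by auto
  define D where "D = fdet K (\<lambda>r c. divdiff X (\<lambda>x. x ^ r * qspline q (N - K - 1) (ys ! c) x))"
  have "iterated_vline_integral cs (\<lambda>zs.
      vandermonde (map inverse zs) *
      (\<Prod>j<K.
        qpoch (complex_of_real (ys ! j) * inverse (zs ! j) * complex_of_real q) (complex_of_real q) (card X - K - 1) /
        (\<Prod>x\<in>X. 1 - complex_of_real x * inverse (zs ! j)) *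
        (1 / (zs ! j)\<^sup>2))) =
    (2 * of_real pi * \<i>) ^ K *
    of_real (fdet K (\<lambda>r c. divdiff X (\<lambda>x. x ^ r * qspline q (card X - K - 1) (ys ! c) x)))"
  proof (rule iterated_vline_integral_splines)
    fix j assume j: "j < K"
    have c: "min (ys ! j) (ys ! j * q) < cs ! j" "cs ! j < max (ys ! j) (ys ! j * q)"
      using assms(12)[OF j] by auto
    show "cs ! j \<notin> X" using contour_separates(2)[OF ysL[OF j] c] Xc by auto
    show "ys ! j > 0 \<and> cs ! j > 0 \<and> (\<forall>x\<in>X. cs ! j < x \<longleftrightarrow> ys ! j \<le> x) \<or>
       ys ! j < 0 \<and> cs ! j < 0 \<and> (\<forall>x\<in>X. x < cs ! j \<longleftrightarrow> x \<le> ys ! j)"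
      using contour_separates(1)[OF ysL[OF j] c] Xc(3) by (meson subsetD)
  qed (use assms Xc len in auto)
  then have integral: "iterated_vline_integral cs (\<lambda>zs.
      vandermonde (map inverse zs) *
      (\<Prod>j<K.
        qpoch (complex_of_real (ys ! j) * inverse (zs ! j) * complex_of_real q) (complex_of_real q) (N - K - 1) /
        (\<Prod>x\<in>X. 1 - complex_of_real x * inverse (zs ! j)) *
        (1 / (zs ! j)\<^sup>2))) = (2 * of_real pi * \<i>) ^ K * of_real D"
    using Xc by (simp add: D_def)
  have prodY: "(\<Prod>y\<in>Y. \<bar>y\<bar>) = (\<Prod>j<K. \<bar>ys ! j\<bar>)"
    using assms(9,10) len by (intro prod.reindex_bij_betw[symmetric] bij_betw_nth) auto
  have V: "vandermonde (descending_list X) \<noteq> 0"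
    using vandermonde_descending_list(1)[of X] Xc by simp
  \<comment> \<open>The factor V(X) produced here cancels the denominator in
    \<open>link_det\<close>, leaving the determinant \<open>D\<close> that the iterated integral
    also yields.\<close>
  have "fdet N (\<lambda>i c. entry K ys N c (descending_list X ! i)) = vandermonde (descending_list X) * D"
    using fdet_divdiff[of "descending_list X" K "\<lambda>c. qspline q (N - K - 1) (ys ! c)"] Xc assms(6)
    by (simp add: entry_def D_def descending_list_basic cong: if_cong)
  then have "link q zp zm K N X Y = link_coeff q K N * vandermonde ys * (\<Prod>j<K. \<bar>ys ! j\<bar>) * D"
    using link_det[OF Y assms(9,10,6) X] V by (simp add: prodY)
  moreover have "(2 * complex_of_real pi * \<i>) ^ K \<noteq> 0" by simp
  ultimately show ?thesis
    unfolding integral by (simp add: link_coeff_def del: of_real_prod)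
qed

end
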